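(* Let $M$ be a semifinite von Neumann algebra with a faithful normal semifinite trace $\tau$, and let $L=L(M,\tau)$ be the $*$-algebra of $\tau$-measurable operators, equipped with the measure topology $t_\tau$. Let $M_1=\{x\in M:\|x\|\le 1\}$. Let $a_n:M\to L$, $n=1,2,\dots$, be a sequence of additive maps that is uniformly equicontinuous at $0$ on $M_1$. Then the set $$C(M_1)=\{x\in M_1:\{a_n(x)\}\text{ converges almost uniformly in }L\}$$ is closed in $(M_1,t_\tau)$.
   Context: $M$ acts on a Hilbert space $H$ and has unit $I$; $\|\cdot\|$ is the uniform (operator) norm; $P(M)$ is the lattice of projections in $M$; $e^\perp=I-e$ for $e\in P(M)$. A densely defined closed operator $x$ affiliated with $M$ is $\tau$-measurable if for each $\epsilon>0$ there is $e\in P(M)$ with $\tau(e^\perp)\le\epsilon$ such that $eH$ lies in the domain of $x$. $L=L(M,\tau)$ is the set of all $\tau$-measurable operators affiliated with $M$, a $*$-algebra under strong sum and strong product (closures of the algebraic ones); $M\subset L$. The measure topology $t_\tau$ on $L$ is the one having as a base of neighborhoods of zero the sets $V(\epsilon,\delta)=\{x\in L:\|xe\|\le\delta\text{ for some }e\in P(M)\text{ with }\tau(e^\perp)\le\epsilon\}$, $\epsilon,\delta>0$. For $z\in L$, writing $\|z\|\le\delta$ includes the assertion that $z\in M$. $(M_1,t_\tau)$ carries the subspace topology. Almost uniform convergence: $\{y_n\}\subset L$ converges almost uniformly (a.u.) to $y\in L$ if for every $\epsilon>0$ there is $e\in P(M)$ with $\tau(e^\perp)\le\epsilon$ and $\|(y-y_n)e\|\to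 0$. Uniform equicontinuity: let $0\in E\subset M$ and let $a_n:M\to L$ satisfy $a_n(0)=0$ for all $n$. The sequence $\{a_n\}$ is uniformly equicontinuous at $0$ on $E$ if for all $\epsilon>0$, $\delta>0$ there is a neighborhood $U$ of $0$ in $(M,t_\tau)$ such that for every $x\in E\cap U$ there is a projection $e=e(x)\in P(M)$ with $\tau(e^\perp)\le\epsilon$, $a_n(x)e\in M$ for all $n$, and $\sup_n\|a_n(x)e\|\le\delta$. *)

theory Defs
  imports "HOL-Analysis.Analysis"
begin

section \<open>Complex Hilbert spaces\<close>

text \<open>The inner product is linear in its first argument. The last axiom makes it positive
  definite and the norm the one it induces; completeness is part of \<^class>\<open>banach\<close>.\<close>

class complex_hilbert_space = banach +
  fixes scaleC :: "complex \<Rightarrow> 'a \<Rightarrow> 'a"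
    and cinner :: "'a \<Rightarrow> 'a \<Rightarrow> complex"
  assumes scaleC_add_right: "scaleC c (x + y) = scaleC c x + scaleC c y"
    and scaleC_add_left: "scaleC (c + d) x = scaleC c x + scaleC d x"
    and scaleC_scaleC: "scaleC c (scaleC d x) = scaleC (c * d) x"
    and scaleC_one: "scaleC 1 x = x"
    and scaleR_scaleC: "scaleR r x = scaleC (complex_of_real r) x"
    and cinner_commute: "cinner x y = cnj (cinner y x)"
    and cinner_add_left: "cinner (x + y) z = cinner x z + cinner y z"
    and cinner_scaleC_left: "cinner (scaleC c x) y = c * cinner x y"
    and cinner_norm: "cinner x x = complex_of_real ((norm x)\<^sup>2)"


section \<open>Von Neumann algebras\<close>

text \<open>The elements of \<^typ>\<open>'h \<Rightarrow>\<^sub>L 'h\<close> are the bounded real-linear operators; \<open>B(H)\<close> consists of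
  the complex-linear ones. The norm of \<^typ>\<open>'h \<Rightarrow>\<^sub>L 'h\<close> is the operator norm.\<close>

definition bounded_ops :: "('h::complex_hilbert_space \<Rightarrow>\<^sub>L 'h) set" where
  "bounded_ops = {T. \<forall>c x. blinfun_apply T (scaleC c x) = scaleC c (blinfun_apply T x)}"

definition adj :: "('h::complex_hilbert_space \<Rightarrow>\<^sub>L 'h) \<Rightarrow> 'h \<Rightarrow>\<^sub>L 'h" where
  "adj T = (THE S. \<forall>x y. cinner (blinfun_apply T x) y = cinner x (blinfun_apply S y))"

definition commutant :: "('h::complex_hilbert_space \<Rightarrow>\<^sub>L 'h) set \<Rightarrow> ('h \<Rightarrow>\<^sub>L 'h) set" where
  "commutant S = {y \<in> bounded_ops. \<forall>x\<in>S. x o\<^sub>L y = y o\<^sub>L x}"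

definition von_neumann_algebra :: "('h::complex_hilbert_space \<Rightarrow>\<^sub>L 'h) set \<Rightarrow> bool" where
  "von_neumann_algebra M \<longleftrightarrow>
     M \<subseteq> bounded_ops \<and> (\<forall>x\<in>M. adj x \<in> M) \<and> commutant (commutant M) = M"

definition projections :: "('h::complex_hilbert_space \<Rightarrow>\<^sub>L 'h) set \<Rightarrow> ('h \<Rightarrow>\<^sub>L 'h) set" where
  "projections M = {e \<in> M. e o\<^sub>L e = e \<and> adj e = e}"

definition perp :: "('h::complex_hilbert_space \<Rightarrow>\<^sub>L 'h) \<Rightarrow> 'h \<Rightarrow>\<^sub>L 'h" where
  "perp e = id_blinfun - e"

definition unit_ball :: "('h::complex_hilbert_space \<Rightarrow>\<^sub>L 'h) set \<Rightarrow> ('h \<Rightarrow>\<^sub>L 'h) set" where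
  "unit_ball M = {x \<in> M. norm x \<le> 1}"


section \<open>Traces\<close>

definition positive_op :: "('h::complex_hilbert_space \<Rightarrow>\<^sub>L 'h) \<Rightarrow> bool" where
  "positive_op T \<longleftrightarrow> T \<in> bounded_ops \<and>
     (\<forall>x. Im (cinner (blinfun_apply T x) x) = 0 \<and> 0 \<le> Re (cinner (blinfun_apply T x) x))"

definition op_le :: "('h::complex_hilbert_space \<Rightarrow>\<^sub>L 'h) \<Rightarrow> ('h \<Rightarrow>\<^sub>L 'h) \<Rightarrow> bool" where
  "op_le x y \<longleftrightarrow> positive_op (y - x)"

definition positive_cone :: "('h::complex_hilbert_space \<Rightarrow>\<^sub>L 'h) set \<Rightarrow> ('h \<Rightarrow>\<^sub>L 'h) set" where
  "positive_cone M = {x \<in> M. positive_op x}"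

text \<open>Only the values of \<open>\<tau>\<close> on the positive cone matter. In \<^typ>\<open>ennreal\<close>, \<open>0 * \<infinity> = 0\<close>.\<close>

definition trace_on ::
    "('h::complex_hilbert_space \<Rightarrow>\<^sub>L 'h) set \<Rightarrow> (('h \<Rightarrow>\<^sub>L 'h) \<Rightarrow> ennreal) \<Rightarrow> bool" where
  "trace_on M \<tau> \<longleftrightarrow>
     (\<forall>x\<in>positive_cone M. \<forall>y\<in>positive_cone M. \<tau> (x + y) = \<tau> x + \<tau> y) \<and>
     (\<forall>x\<in>positive_cone M. \<forall>r\<ge>0. \<tau> (r *\<^sub>R x) = ennreal r * \<tau> x) \<and>
     (\<forall>x\<in>M. \<tau> (adj x o\<^sub>L x) = \<tau> (x o\<^sub>L adj x))"

definition faithful_trace ::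
    "('h::complex_hilbert_space \<Rightarrow>\<^sub>L 'h) set \<Rightarrow> (('h \<Rightarrow>\<^sub>L 'h) \<Rightarrow> ennreal) \<Rightarrow> bool" where
  "faithful_trace M \<tau> \<longleftrightarrow> (\<forall>x\<in>positive_cone M. \<tau> x = 0 \<longrightarrow> x = 0)"

text \<open>Upward directed subsets of the positive cone take the place of increasing nets.\<close>

definition normal_trace ::
    "('h::complex_hilbert_space \<Rightarrow>\<^sub>L 'h) set \<Rightarrow> (('h \<Rightarrow>\<^sub>L 'h) \<Rightarrow> ennreal) \<Rightarrow> bool" where
  "normal_trace M \<tau> \<longleftrightarrow>
     (\<forall>D s. D \<subseteq> positive_cone M \<and> D \<noteq> {} \<and>
        (\<forall>x\<in>D. \<forall>y\<in>D. \<exists>z\<in>D. op_le x z \<and> op_le y z) \<and>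
        s \<in> positive_cone M \<and> (\<forall>x\<in>D. op_le x s) \<and>
        (\<forall>t\<in>positive_cone M. (\<forall>x\<in>D. op_le x t) \<longrightarrow> op_le s t)
        \<longrightarrow> \<tau> s = (SUP x\<in>D. \<tau> x))"

definition semifinite_trace ::
    "('h::complex_hilbert_space \<Rightarrow>\<^sub>L 'h) set \<Rightarrow> (('h \<Rightarrow>\<^sub>L 'h) \<Rightarrow> ennreal) \<Rightarrow> bool" where
  "semifinite_trace M \<tau> \<longleftrightarrow>
     (\<forall>x\<in>positive_cone M. x \<noteq> 0 \<longrightarrow>
        (\<exists>y\<in>positive_cone M. y \<noteq> 0 \<and> op_le y x \<and> \<tau> y < \<infinity>))"

text \<open>A von Neumann algebra is semifinite iff it carries such a trace.\<close>

definition fns_trace ::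
    "('h::complex_hilbert_space \<Rightarrow>\<^sub>L 'h) set \<Rightarrow> (('h \<Rightarrow>\<^sub>L 'h) \<Rightarrow> ennreal) \<Rightarrow> bool" where
  "fns_trace M \<tau> \<longleftrightarrow>
     trace_on M \<tau> \<and> faithful_trace M \<tau> \<and> normal_trace M \<tau> \<and> semifinite_trace M \<tau>"


section \<open>Unbounded and measurable operators\<close>

text \<open>A partially defined operator is represented by its graph, so that equality of operators
  includes equality of domains, the domain is \<^const>\<open>Domain\<close>, and the closure of an operator is
  the topological closure of its graph in the product space.\<close>

type_synonym 'h operator = "('h \<times> 'h) set"

definition linear_operator :: "'h::complex_hilbert_space operator \<Rightarrow> bool" where
  "linear_operator A \<longleftrightarrow> single_valued A \<and> (0, 0) \<in> A \<and>
     (\<forall>x y u v. (x, u) \<in> A \<and> (y, v) \<in> A \<longrightarrow> (x + y, u + v) \<in> A) \<and>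
     (\<forall>c x u. (x, u) \<in> A \<longrightarrow> (scaleC c x, scaleC c u) \<in> A)"

definition closed_densely_defined :: "'h::complex_hilbert_space operator \<Rightarrow> bool" where
  "closed_densely_defined A \<longleftrightarrow> linear_operator A \<and> closed A \<and> closure (Domain A) = UNIV"

definition graph_of :: "('h::complex_hilbert_space \<Rightarrow>\<^sub>L 'h) \<Rightarrow> 'h operator" where
  "graph_of T = {(x, blinfun_apply T x) | x. True}"

text \<open>The inclusion \<open>y A \<subseteq> A y\<close> for every \<open>y\<close> in the commutant of \<open>M\<close>.\<close>

definition affiliated ::
    "('h::complex_hilbert_space \<Rightarrow>\<^sub>L 'h) set \<Rightarrow> 'h operator \<Rightarrow> bool" where
  "affiliated M A \<longleftrightarrow> (\<forall>y\<in>commutant M. A O graph_of y \<subseteq> graph_of y O A)"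

definition measurable_ops ::
    "('h::complex_hilbert_space \<Rightarrow>\<^sub>L 'h) set \<Rightarrow> (('h \<Rightarrow>\<^sub>L 'h) \<Rightarrow> ennreal) \<Rightarrow> 'h operator set" where
  "measurable_ops M \<tau> = {A. closed_densely_defined A \<and> affiliated M A \<and>
     (\<forall>\<epsilon>>0. \<exists>e\<in>projections M. \<tau> (perp e) \<le> ennreal \<epsilon> \<and> range (blinfun_apply e) \<subseteq> Domain A)}"

definition strong_sum ::
    "'h::complex_hilbert_space operator \<Rightarrow> 'h operator \<Rightarrow> 'h operator" where
  "strong_sum A B = closure {(x, u + v) | x u v. (x, u) \<in> A \<and> (x, v) \<in> B}"

definition strong_diff ::
    "'h::complex_hilbert_space operator \<Rightarrow> 'h operator \<Rightarrow> 'h operator" where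
  "strong_diff A B = closure {(x, u - v) | x u v. (x, u) \<in> A \<and> (x, v) \<in> B}"

text \<open>Relational composition applies its left argument first, hence the reversed order.\<close>

definition strong_prod ::
    "'h::complex_hilbert_space operator \<Rightarrow> 'h operator \<Rightarrow> 'h operator" where
  "strong_prod A B = closure (B O A)"

text \<open>The uniform norm on measurable operators, with value \<open>\<infinity>\<close> outside \<open>M\<close>: a finite bound on
  it includes the assertion that the operator belongs to \<open>M\<close>.\<close>

definition unif_norm ::
    "('h::complex_hilbert_space \<Rightarrow>\<^sub>L 'h) set \<Rightarrow> 'h operator \<Rightarrow> ennreal" where
  "unif_norm M A =
     (if A \<in> graph_of ` M then ennreal (norm (inv_into M graph_of A)) else \<infinity>)"


section \<open>The measure topology\<close>

definition meas_nhd ::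
    "('h::complex_hilbert_space \<Rightarrow>\<^sub>L 'h) set \<Rightarrow> (('h \<Rightarrow>\<^sub>L 'h) \<Rightarrow> ennreal) \<Rightarrow> real \<Rightarrow> real
      \<Rightarrow> 'h operator set" where
  "meas_nhd M \<tau> \<epsilon> \<delta> = {A \<in> measurable_ops M \<tau>.
     \<exists>e\<in>projections M. \<tau> (perp e) \<le> ennreal \<epsilon> \<and>
       unif_norm M (strong_prod A (graph_of e)) \<le> ennreal \<delta>}"

text \<open>The neighborhoods of \<open>A\<close> are the translates by \<open>A\<close> of the neighborhoods of zero.\<close>

definition meas_open ::
    "('h::complex_hilbert_space \<Rightarrow>\<^sub>L 'h) set \<Rightarrow> (('h \<Rightarrow>\<^sub>L 'h) \<Rightarrow> ennreal) \<Rightarrow> 'h operator set \<Rightarrow> bool"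
  where
  "meas_open M \<tau> U \<longleftrightarrow> U \<subseteq> measurable_ops M \<tau> \<and>
     (\<forall>A\<in>U. \<exists>\<epsilon>>0. \<exists>\<delta>>0.
        {B \<in> measurable_ops M \<tau>. strong_diff B A \<in> meas_nhd M \<tau> \<epsilon> \<delta>} \<subseteq> U)"

definition measure_topology ::
    "('h::complex_hilbert_space \<Rightarrow>\<^sub>L 'h) set \<Rightarrow> (('h \<Rightarrow>\<^sub>L 'h) \<Rightarrow> ennreal) \<Rightarrow> 'h operator topology"
  where
  "measure_topology M \<tau> = topology (meas_open M \<tau>)"

lemma meas_nhd_mono:
  assumes "\<epsilon> \<le> \<epsilon>'" "\<delta> \<le> \<delta>'"
  shows "meas_nhd M \<tau> \<epsilon> \<delta> \<subseteq> meas_nhd M \<tau> \<epsilon>' \<delta>'"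
  using ennreal_leI[OF assms(1)] ennreal_leI[OF assms(2)]
  unfolding meas_nhd_def by (blast intro: order_trans)

lemma istopology_meas_open: "istopology (meas_open M \<tau>)"
  unfolding istopology_def
proof (intro conjI allI impI)
  fix S T assume S: "meas_open M \<tau> S" and T: "meas_open M \<tau> T"
  show "meas_open M \<tau> (S \<inter> T)"
    unfolding meas_open_def
  proof (intro conjI ballI)
    show "S \<inter> T \<subseteq> measurable_ops M \<tau>" using S by (auto simp: meas_open_def)
  next
    fix A assume "A \<in> S \<inter> T"
    then obtain e1 d1 e2 d2 where pos: "e1 > 0" "d1 > 0" "e2 > 0" "d2 > 0"
      and 1: "{B \<in> measurable_ops M \<tau>. strong_diff B A \<in> meas_nhd M \<tau> e1 d1} \<subseteq> S"
      and 2: "{B \<in> measurable_ops M \<tau>. strong_diff B A \<in> meas_nhd M \<tau> e2 d2} \<subseteq> T"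
      using S T by (fastforce simp: meas_open_def)
    have "meas_nhd M \<tau> (min e1 e2) (min d1 d2) \<subseteq> meas_nhd M \<tau> e1 d1 \<inter> meas_nhd M \<tau> e2 d2"
      by (simp add: meas_nhd_mono)
    then have "{B \<in> measurable_ops M \<tau>.
        strong_diff B A \<in> meas_nhd M \<tau> (min e1 e2) (min d1 d2)} \<subseteq> S \<inter> T"
      using 1 2 by blast
    moreover have "min e1 e2 > 0" "min d1 d2 > 0" using pos by auto
    ultimately show "\<exists>\<epsilon>>0. \<exists>\<delta>>0.
        {B \<in> measurable_ops M \<tau>. strong_diff B A \<in> meas_nhd M \<tau> \<epsilon> \<delta>} \<subseteq> S \<inter> T"
      by blast
  qed
next
  fix \<K> assume "\<forall>K\<in>\<K>. meas_open M \<tau> K"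
  then show "meas_open M \<tau> (\<Union>\<K>)" unfolding meas_open_def by (meson Sup_least Union_iff
    Union_upper subset_trans)
qed

lemma openin_measure_topology: "openin (measure_topology M \<tau>) U \<longleftrightarrow> meas_open M \<tau> U"
  by (simp add: measure_topology_def istopology_meas_open topology_inverse')

lemma topspace_measure_topology: "topspace (measure_topology M \<tau>) = measurable_ops M \<tau>"
proof -
  have "meas_open M \<tau> (measurable_ops M \<tau>)"
    unfolding meas_open_def using zero_less_one by blast
  then show ?thesis
    unfolding topspace_def openin_measure_topology by (auto simp: meas_open_def)
qed

text \<open>The subspace topology on a subset \<open>E\<close> of \<open>M\<close>, where \<open>M\<close> is identified with a subset of the
  measurable operators through the injective map \<^const>\<open>graph_of\<close>.\<close>

definition measure_subtopology ::
    "('h::complex_hilbert_space \<Rightarrow>\<^sub>L 'h) set \<Rightarrow> (('h \<Rightarrow>\<^sub>L 'h) \<Rightarrow> ennreal) \<Rightarrow> ('h \<Rightarrow>\<^sub>L 'h) set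
      \<Rightarrow> ('h \<Rightarrow>\<^sub>L 'h) topology" where
  "measure_subtopology M \<tau> E = pullback_topology E graph_of (measure_topology M \<tau>)"


section \<open>Almost uniform convergence and uniform equicontinuity\<close>

definition converges_au ::
    "('h::complex_hilbert_space \<Rightarrow>\<^sub>L 'h) set \<Rightarrow> (('h \<Rightarrow>\<^sub>L 'h) \<Rightarrow> ennreal)
      \<Rightarrow> (nat \<Rightarrow> 'h operator) \<Rightarrow> 'h operator \<Rightarrow> bool" where
  "converges_au M \<tau> y l \<longleftrightarrow>
     (\<forall>\<epsilon>>0. \<exists>e\<in>projections M. \<tau> (perp e) \<le> ennreal \<epsilon> \<and>
        (\<lambda>n. unif_norm M (strong_prod (strong_diff l (y n)) (graph_of e))) \<longlonglongrightarrow> 0)"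

text \<open>This notion is meant for maps with \<open>a n 0 = 0\<close>, which holds for additive maps, and for
  \<open>0 \<in> E \<subseteq> M\<close>.\<close>

definition uniformly_equicontinuous_at_0 ::
    "('h::complex_hilbert_space \<Rightarrow>\<^sub>L 'h) set \<Rightarrow> (('h \<Rightarrow>\<^sub>L 'h) \<Rightarrow> ennreal) \<Rightarrow> ('h \<Rightarrow>\<^sub>L 'h) set
      \<Rightarrow> (nat \<Rightarrow> ('h \<Rightarrow>\<^sub>L 'h) \<Rightarrow> 'h operator) \<Rightarrow> bool" where
  "uniformly_equicontinuous_at_0 M \<tau> E a \<longleftrightarrow>
     (\<forall>\<epsilon>>0. \<forall>\<delta>>0. \<exists>U. openin (measure_subtopology M \<tau> M) U \<and> 0 \<in> U \<and>
        (\<forall>x\<in>E \<inter> U. \<exists>e\<in>projections M. \<tau> (perp e) \<le> ennreal \<epsilon> \<and>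
           (\<forall>n. strong_prod (a n x) (graph_of e) \<in> graph_of ` M) \<and>
           (SUP n. unif_norm M (strong_prod (a n x) (graph_of e))) \<le> ennreal \<delta>))"

end

theory Submission
  imports Defs
begin

text \<open>Let \<open>x\<close> lie in the closure. For every \<open>\<epsilon>\<close> and \<open>\<delta>\<close> there is a \<open>c = x + 2 y\<close> with \<open>a n c\<close> convergent and
  \<open>y\<close> in the unit ball so small that equicontinuity bounds all \<open>a n y\<close> by \<open>\<delta>\<close> on a projection of cotrace
  at most \<open>\<epsilon>\<close>; since \<open>a n c = a n x + 2 a n y\<close>, the sequence \<open>a n x\<close> is almost uniformly Cauchy. (The
  factor 2 is there because the difference of two elements of the unit ball need not lie in it.) What
  remains is that such sequences converge in \<open>L\<close>, and that strong differences of measurable operators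
  are single-valued. Both rest on the equality of the traces of the left and right supports of an
  element of \<open>M\<close>, which makes the lattice of projections subadditive for the trace and yields, for a
  closed affiliated operator \<open>A\<close> and a projection \<open>e\<close>, a projection \<open>p\<close> with \<open>\<tau> p \<le> \<tau> (1 - e)\<close> that fixes
  the values of \<open>A\<close> on the kernel of \<open>e\<close>.\<close>


section \<open>Complex inner products\<close>

text \<open>A set is open in \<open>L\<close> when around each of its points it contains a translate
  of some basic set; that these translates are themselves neighborhoods would rest on the continuity
  of addition. The proof bypasses this by showing that the complement of \<open>C(M_1)\<close> in
  all of \<open>L\<close> is open. A point of \<open>L\<close> approximated by \<open>C(M_1)\<close>
  must then first be placed in the unit ball, although only its measurability is known.
  Measurability puts \<open>e H\<close> into the domain of \<open>A\<close> without a bound; the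
  bound comes from the closed graph theorem. A large domain does not control values, however: the
  closure of an algebraic difference, or of a union of compatible bounded operators, could become
  multivalued because of what happens off \<open>e H\<close>. Hence the need for a projection on the
  side of the values. For unbounded \<open>A\<close> it is read off from the orthogonal projection
  of \<open>H \<times> H\<close> onto a part of the graph. The passage between left and right
  supports uses polynomial approximation in place of polar decomposition.\<close>

lemma cinner_add_right: "cinner x (y + z) = cinner x y + cinner x z"
  by (metis cinner_add_left cinner_commute complex_cnj_add)

lemma cinner_scaleC_right: "cinner x (scaleC c y) = cnj c * cinner x y"
  by (metis cinner_commute cinner_scaleC_left complex_cnj_mult)

lemma cinner_zero_left [simp]: "cinner 0 y = 0"
  using cinner_add_left[of 0 0 y] by simp

lemma cinner_zero_right [simp]: "cinner x 0 = 0"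
  using cinner_add_right[of x 0 0] by simp

lemma cinner_minus_left: "cinner (- x) y = - cinner x y"
  using cinner_add_left[of x "- x" y] by (simp add: eq_neg_iff_add_eq_0 add.commute)

lemma cinner_minus_right: "cinner x (- y) = - cinner x y"
  using cinner_add_right[of x y "- y"] by (simp add: eq_neg_iff_add_eq_0 add.commute)

lemma cinner_diff_left: "cinner (x - y) z = cinner x z - cinner y z"
  using cinner_add_left[of x "- y" z] by (simp add: cinner_minus_left)

lemma cinner_diff_right: "cinner x (y - z) = cinner x y - cinner x z"
  using cinner_add_right[of x y "- z"] by (simp add: cinner_minus_right)

lemmas cinner_simps = cinner_add_left cinner_add_right cinner_diff_left cinner_diff_right
  cinner_minus_left cinner_minus_right cinner_scaleC_left cinner_scaleC_right

lemma cinner_scaleR_left: "cinner (r *\<^sub>R x) y = complex_of_real r * cinner x y"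
  by (simp add: scaleR_scaleC cinner_scaleC_left)

lemma cinner_scaleR_right: "cinner x (r *\<^sub>R y) = complex_of_real r * cinner x y"
  by (simp add: scaleR_scaleC cinner_scaleC_right)

lemma cinner_eq_0_commute: "cinner x y = 0 \<longleftrightarrow> cinner y x = 0"
  by (metis cinner_commute complex_cnj_zero)

lemma norm_sq_cinner: "(norm x)\<^sup>2 = Re (cinner x x)"
  by (simp add: cinner_norm)

lemma cinner_self_eq_0 [simp]: "cinner x x = 0 \<longleftrightarrow> x = 0"
  by (simp add: cinner_norm)

lemma cinner_ext: "(\<And>z. cinner x z = cinner y z) \<Longrightarrow> x = y"
  by (metis cinner_diff_left cinner_self_eq_0 eq_iff_diff_eq_0)

lemma cinner_ext_right: "(\<And>z. cinner z x = cinner z y) \<Longrightarrow> x = y"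
  by (metis cinner_diff_right cinner_self_eq_0 eq_iff_diff_eq_0)

lemma scaleC_zero_right [simp]: "scaleC c 0 = (0 :: 'a::complex_hilbert_space)"
  by (rule cinner_ext) (simp add: cinner_scaleC_left)

lemma scaleC_diff_right: "scaleC c (x - y) = scaleC c x - scaleC c (y :: 'a::complex_hilbert_space)"
  by (rule cinner_ext) (simp add: cinner_simps algebra_simps)

lemma scaleC_scaleR: "scaleC c (r *\<^sub>R x) = r *\<^sub>R scaleC c (x :: 'a::complex_hilbert_space)"
  by (simp add: scaleR_scaleC scaleC_scaleC mult.commute)

lemma norm_scaleC: "norm (scaleC c x) = cmod c * norm (x :: 'a::complex_hilbert_space)"
proof -
  have "complex_of_real ((norm (scaleC c x))\<^sup>2) = c * cnj c * complex_of_real ((norm x)\<^sup>2)"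
    by (simp only: cinner_norm[symmetric] cinner_simps) simp
  also have "\<dots> = complex_of_real ((cmod c * norm x)\<^sup>2)"
    by (simp add: complex_norm_square[symmetric] power_mult_distrib)
  finally have "(norm (scaleC c x))\<^sup>2 = (cmod c * norm x)\<^sup>2"
    using of_real_eq_iff by blast
  then show ?thesis by (simp add: power2_eq_iff_nonneg)
qed

lemma norm_diff_sq:
  fixes x y :: "'a::complex_hilbert_space"
  shows "(norm (x - y))\<^sup>2 = (norm x)\<^sup>2 + (norm y)\<^sup>2 - 2 * Re (cinner x y)"
proof -
  have "Re (cinner y x) = Re (cinner x y)"
    by (metis cinner_commute complex_cnj(1) complex.sel(1) complex.collapse)
  then show ?thesis by (simp add: norm_sq_cinner cinner_simps)
qed

lemma norm_add_sq:
  fixes x y :: "'a::complex_hilbert_space"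
  shows "(norm (x + y))\<^sup>2 = (norm x)\<^sup>2 + (norm y)\<^sup>2 + 2 * Re (cinner x y)"
  using norm_diff_sq[of x "- y"] by (simp add: cinner_minus_right)

text \<open>The vector subtracted is the component of \<open>u\<close> along \<open>z\<close>.
  Nonnegativity of the left side gives Cauchy-Schwarz, and minimality of a nearest point gives its
  orthogonality relation.\<close>

lemma norm_diff_scaleC_sq:
  fixes u z :: "'a::complex_hilbert_space"
  assumes "z \<noteq> 0"
  shows "(norm (u - scaleC (cinner u z / complex_of_real ((norm z)\<^sup>2)) z))\<^sup>2
    = (norm u)\<^sup>2 - (cmod (cinner u z))\<^sup>2 / (norm z)\<^sup>2"
proof -
  let ?c = "cinner u z / complex_of_real ((norm z)\<^sup>2)"
  have "cinner u (scaleC ?c z) = complex_of_real ((cmod (cinner u z))\<^sup>2 / (norm z)\<^sup>2)"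
    using complex_norm_square[of "cinner u z"]
    by (simp add: cinner_scaleC_right mult.commute)
  moreover have "(norm (scaleC ?c z))\<^sup>2 = (cmod (cinner u z))\<^sup>2 / (norm z)\<^sup>2"
    using assms by (simp add: norm_scaleC norm_divide power2_eq_square norm_mult)
  ultimately show ?thesis by (simp add: norm_diff_sq)
qed

lemma cinner_Cauchy_Schwarz:
  fixes x y :: "'a::complex_hilbert_space"
  shows "cmod (cinner x y) \<le> norm x * norm y"
proof (cases "y = 0")
  case False
  then have "(cmod (cinner x y))\<^sup>2 / (norm y)\<^sup>2 \<le> (norm x)\<^sup>2"
    using norm_diff_scaleC_sq[OF False, of x]
    by (metis diff_ge_0_iff_ge zero_le_power2)
  then have "(cmod (cinner x y))\<^sup>2 \<le> (norm x * norm y)\<^sup>2"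
    using False by (simp add: field_simps power_mult_distrib)
  then show ?thesis by (simp add: power2_le_iff_abs_le)
qed simp

lemma bounded_linear_cinner_left: "bounded_linear (\<lambda>x :: 'a::complex_hilbert_space. cinner x y)"
  by (rule bounded_linear_intro[where K = "norm y"])
    (simp_all add: cinner_simps cinner_scaleR_left cinner_Cauchy_Schwarz scaleR_conv_of_real)

lemma bounded_linear_scaleC: "bounded_linear (\<lambda>x :: 'a::complex_hilbert_space. scaleC c x)"
  by (rule bounded_linear_intro[where K = "cmod c"])
    (simp_all add: scaleC_add_right scaleC_scaleR norm_scaleC mult.commute)


section \<open>Orthogonal projections and adjoints\<close>

definition csubspace :: "'a::complex_hilbert_space set \<Rightarrow> bool" where
  "csubspace N \<longleftrightarrow> 0 \<in> N \<and> (\<forall>x\<in>N. \<forall>y\<in>N. x + y \<in> N) \<and> (\<forall>c. \<forall>x\<in>N. scaleC c x \<in> N)"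

definition ocomp :: "'a::complex_hilbert_space set \<Rightarrow> 'a set" where
  "ocomp S = {x. \<forall>y\<in>S. cinner x y = 0}"

lemma csubspace_diff: "csubspace N \<Longrightarrow> x \<in> N \<Longrightarrow> y \<in> N \<Longrightarrow> x - y \<in> N"
  unfolding csubspace_def
  by (metis diff_conv_add_uminus scaleR_minus1_left scaleR_scaleC)

lemma csubspace_ocomp: "csubspace (ocomp S)"
  by (simp add: csubspace_def ocomp_def cinner_simps)

text \<open>The parallelogram law makes a minimizing sequence Cauchy: the midpoint of two of its
  members lies in \<open>N\<close> and is therefore no closer to \<open>x\<close> than
  \<open>d\<close>.\<close>

lemma exists_nearest_point:
  fixes N :: "'a::complex_hilbert_space set"
  assumes N: "csubspace N" "closed N"
  shows "\<exists>y\<in>N. \<forall>w\<in>N. norm (x - y) \<le> norm (x - w)"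
proof -
  have ne: "N \<noteq> {}" using N by (auto simp: csubspace_def)
  define d where "d = infdist x N"
  have d0: "d \<ge> 0" by (simp add: d_def infdist_nonneg)
  have dle: "d \<le> norm (x - w)" if "w \<in> N" for w
    using infdist_le[OF that, of x] by (simp add: d_def dist_norm)
  have "\<exists>y\<in>N. norm (x - y) < d + 1 / real (Suc n)" for n
  proof (rule ccontr)
    assume "\<not> ?thesis"
    then have "d + 1 / real (Suc n) \<le> dist x y" if "y \<in> N" for y
      using that by (auto simp: dist_norm not_less)
    then have "d + 1 / real (Suc n) \<le> infdist x N"
      using ne by (auto simp: infdist_def intro: cINF_greatest)
    moreover have "1 / real (Suc n) > 0" by simp
    ultimately show False by (simp add: d_def)
  qed
  then obtain s where s: "\<And>n. s n \<in> N" "\<And>n. norm (x - s n) < d + 1 / real (Suc n)"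
    by metis
  \<comment> \<open>The constant comes from
    \<open>4 * (d + t)^2 - 4 * d^2 = 4 * (2 * d + t) * t\<close> with
    \<open>t = 1 / Suc k \<le> 1\<close>.\<close>
  have est: "(norm (s m - s n))\<^sup>2 \<le> 4 * (2 * d + 1) / real (Suc k)" if "k \<le> m" "k \<le> n" for m n k
  proof -
    let ?t = "1 / real (Suc k)"
    have le: "norm (x - s i) \<le> d + ?t" if "k \<le> i" for i
    proof -
      have "1 / real (Suc i) \<le> ?t" using that by (simp add: field_simps)
      then show ?thesis using s(2)[of i] by linarith
    qed
    have sq: "(norm (x - s i))\<^sup>2 \<le> (d + ?t)\<^sup>2" if "k \<le> i" for i
      using le[OF that] by (simp add: power_mono)
    have "(norm ((x - s m) - (x - s n)))\<^sup>2 + (norm ((x - s m) + (x - s n)))\<^sup>2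
      = 2 * (norm (x - s m))\<^sup>2 + 2 * (norm (x - s n))\<^sup>2"
      by (simp only: norm_diff_sq norm_add_sq) (simp add: algebra_simps)
    moreover have "(norm ((x - s m) + (x - s n)))\<^sup>2 \<ge> 4 * d\<^sup>2"
    proof -
      have "(1/2) *\<^sub>R (s m + s n) \<in> N"
        using N s(1) by (auto simp: csubspace_def scaleR_scaleC)
      then have "d \<le> norm (x - (1/2) *\<^sub>R (s m + s n))" by (rule dle)
      also have "x - (1/2) *\<^sub>R (s m + s n) = (1/2) *\<^sub>R ((x - s m) + (x - s n))"
      proof -
        have "(x - s m) + (x - s n) = (x + x) - (s m + s n)" by simp
        then show ?thesis by (simp only: scaleR_diff_right scaleR_half_double)
      qed
      finally have "2 * d \<le> norm ((x - s m) + (x - s n))" by simp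
      then have "(2 * d)\<^sup>2 \<le> (norm ((x - s m) + (x - s n)))\<^sup>2"
        using d0 by (intro power_mono) auto
      then show ?thesis by (simp add: power_mult_distrib)
    qed
    ultimately have "(norm (s m - s n))\<^sup>2 \<le> 4 * (d + ?t)\<^sup>2 - 4 * d\<^sup>2"
      using sq[OF that(1)] sq[OF that(2)] by (simp add: norm_minus_commute)
    also have "\<dots> = 4 * (2 * d + ?t) * ?t"
      by (simp add: power2_eq_square algebra_simps)
    also have "\<dots> \<le> 4 * (2 * d + 1) * ?t"
      by (intro mult_right_mono mult_left_mono add_left_mono) auto
    finally show ?thesis by simp
  qed
  have "Cauchy s"
  proof (rule metric_CauchyI)
    fix e :: real assume e: "e > 0"
    obtain k where k: "4 * (2 * d + 1) / e\<^sup>2 < real (Suc k)"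
      using reals_Archimedean2[of "4 * (2 * d + 1) / e\<^sup>2"]
      by (metis less_trans lessI of_nat_less_iff)
    have "4 * (2 * d + 1) / real (Suc k) < e\<^sup>2"
      using k e d0 by (simp add: field_simps)
    then have "norm (s m - s n) < e" if "k \<le> m" "k \<le> n" for m n
      using est[OF that] e by (meson le_less_trans power_less_imp_less_base less_imp_le)
    then show "\<exists>k. \<forall>m\<ge>k. \<forall>n\<ge>k. dist (s m) (s n) < e" by (auto simp: dist_norm)
  qed
  then obtain y where y: "s \<longlonglongrightarrow> y" using Cauchy_convergent convergent_def by blast
  have yN: "y \<in> N" using closed_sequentially[OF N(2) _ y] s(1) by blast
  have "(\<lambda>n. d + 1 / real (Suc n)) \<longlonglongrightarrow> d + 0"
    by (intro tendsto_add tendsto_const LIMSEQ_Suc lim_1_over_n)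
  moreover have "(\<lambda>n. norm (x - s n)) \<longlonglongrightarrow> norm (x - y)"
    by (intro tendsto_intros y)
  ultimately have "norm (x - y) \<le> d + 0"
    using s(2) by (intro LIMSEQ_le) (auto intro: less_imp_le)
  then have "norm (x - y) \<le> norm (x - w)" if "w \<in> N" for w
    using dle[OF that] by simp
  then show ?thesis using yN by blast
qed

lemma exists_orthogonal_projection:
  fixes N :: "'a::complex_hilbert_space set"
  assumes N: "csubspace N" "closed N"
  shows "\<exists>y\<in>N. x - y \<in> ocomp N"
proof -
  obtain y where y: "y \<in> N" "\<And>w. w \<in> N \<Longrightarrow> norm (x - y) \<le> norm (x - w)"
    using exists_nearest_point[OF N] by blast
  have "cinner (x - y) z = 0" if z: "z \<in> N" for z
  proof (cases "z = 0")
    case False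
    let ?c = "cinner (x - y) z / complex_of_real ((norm z)\<^sup>2)"
    have "y + scaleC ?c z \<in> N" using N y(1) z by (auto simp: csubspace_def)
    then have "norm (x - y) \<le> norm ((x - y) - scaleC ?c z)"
      using y(2) by (metis diff_diff_add)
    then have "(norm (x - y))\<^sup>2 \<le> (norm ((x - y) - scaleC ?c z))\<^sup>2"
      by (simp add: power_mono)
    then have "(cmod (cinner (x - y) z))\<^sup>2 / (norm z)\<^sup>2 \<le> 0"
      using norm_diff_scaleC_sq[OF False, of "x - y"] by linarith
    then show ?thesis using False by (simp add: divide_le_0_iff)
  qed simp
  then show ?thesis using y(1) by (auto simp: ocomp_def)
qed

lemma orthogonal_projection_unique:
  assumes "csubspace N" "y \<in> N" "x - y \<in> ocomp N" "z \<in> N" "x - z \<in> ocomp N"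
  shows "y = z"
proof -
  have "y - z \<in> N" using csubspace_diff assms by blast
  moreover have "(x - z) - (x - y) \<in> ocomp N"
    using csubspace_diff[OF csubspace_ocomp] assms by blast
  then have "y - z \<in> ocomp N" by simp
  ultimately have "cinner (y - z) (y - z) = 0" by (simp add: ocomp_def)
  then show ?thesis by simp
qed

definition proj_onto :: "'h::complex_hilbert_space set \<Rightarrow> 'h \<Rightarrow>\<^sub>L 'h" where
  "proj_onto N = Blinfun (\<lambda>x. THE y. y \<in> N \<and> x - y \<in> ocomp N)"

lemma proj_onto_bounded_ops:
  assumes N: "csubspace N" "closed N"
  shows proj_onto_in: "proj_onto N x \<in> N"
    and diff_proj_onto: "x - proj_onto N x \<in> ocomp N"
    and proj_onto_in_bounded_ops: "proj_onto N \<in> bounded_ops"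
proof -
  define p where "p x = (THE y. y \<in> N \<and> x - y \<in> ocomp N)" for x
  have ex: "\<exists>!y. y \<in> N \<and> x - y \<in> ocomp N" for x
    using exists_orthogonal_projection[OF N] orthogonal_projection_unique[OF N(1)] by blast
  have p: "p x \<in> N" "x - p x \<in> ocomp N" for x
    using theI'[OF ex[of x]] by (auto simp: p_def)
  have pI: "p x = y" if "y \<in> N" "x - y \<in> ocomp N" for x y
    using that p orthogonal_projection_unique[OF N(1)] by blast
  have add: "p (x + y) = p x + p y" for x y
  proof (rule pI)
    show "p x + p y \<in> N" using p N by (auto simp: csubspace_def)
    have "(x - p x) + (y - p y) \<in> ocomp N" using p csubspace_ocomp[of N] by (auto simp: csubspace_def)
    then show "x + y - (p x + p y) \<in> ocomp N" by (simp add: algebra_simps)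
  qed
  have scale: "p (scaleC c x) = scaleC c (p x)" for c x
  proof (rule pI)
    show "scaleC c (p x) \<in> N" using p N by (auto simp: csubspace_def)
    have "scaleC c (x - p x) \<in> ocomp N" using p csubspace_ocomp[of N] by (auto simp: csubspace_def)
    then show "scaleC c x - scaleC c (p x) \<in> ocomp N" by (simp add: scaleC_diff_right)
  qed
  have bound: "norm (p x) \<le> norm x" for x
  proof -
    have "cinner (x - p x) (p x) = 0" using p by (auto simp: ocomp_def)
    then have "(norm ((x - p x) + p x))\<^sup>2 = (norm (x - p x))\<^sup>2 + (norm (p x))\<^sup>2"
      by (simp only: norm_add_sq) simp
    then have "(norm (p x))\<^sup>2 \<le> (norm x)\<^sup>2" by simp
    then show ?thesis by (simp add: power2_le_iff_abs_le)
  qed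
  have "bounded_linear p"
    by (rule bounded_linear_intro[where K = 1]) (use add bound in \<open>auto simp: scaleR_scaleC scale\<close>)
  then have app: "blinfun_apply (proj_onto N) = p"
    unfolding proj_onto_def p_def by (rule bounded_linear_Blinfun_apply)
  show "proj_onto N x \<in> N" "x - proj_onto N x \<in> ocomp N" using p app by auto
  show "proj_onto N \<in> bounded_ops" by (simp add: bounded_ops_def app scale)
qed

lemma proj_onto_eqI:
  assumes "csubspace N" "closed N" "y \<in> N" "x - y \<in> ocomp N"
  shows "proj_onto N x = y"
  using assms orthogonal_projection_unique proj_onto_in diff_proj_onto by blast

lemma proj_onto_ident:
  assumes "csubspace N" "closed N" "x \<in> N"
  shows "proj_onto N x = x"
  by (rule proj_onto_eqI) (use assms csubspace_ocomp[of N] in \<open>auto simp: csubspace_def\<close>)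

lemma proj_onto_eq_0:
  assumes "csubspace N" "closed N" "x \<in> ocomp N"
  shows "proj_onto N x = 0"
  by (rule proj_onto_eqI) (use assms in \<open>auto simp: csubspace_def\<close>)

lemma proj_onto_selfadjoint:
  assumes N: "csubspace N" "closed N"
  shows "cinner (proj_onto N x) y = cinner x (proj_onto N y)"
proof -
  have 1: "cinner (x - proj_onto N x) (proj_onto N y) = 0"
    using diff_proj_onto[OF N, of x] proj_onto_in[OF N, of y] by (simp add: ocomp_def)
  have 2: "cinner (y - proj_onto N y) (proj_onto N x) = 0"
    using diff_proj_onto[OF N, of y] proj_onto_in[OF N, of x] by (simp add: ocomp_def)
  then have 2: "cinner (proj_onto N x) (y - proj_onto N y) = 0"
    by (simp add: cinner_eq_0_commute)
  show ?thesis using 1 2 by (simp add: cinner_simps)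
qed

text \<open>The remainder \<open>x - proj_onto N x\<close> is orthogonal to \<open>N\<close>, hence
  to \<open>S\<close>, hence zero. This is the criterion by which later arguments pass from a total
  set to the whole space.\<close>

lemma closed_csubspace_eq_UNIV:
  assumes N: "csubspace N" "closed N" and S: "S \<subseteq> N" and o: "\<And>x. x \<in> ocomp S \<Longrightarrow> x = 0"
  shows "x \<in> N"
proof -
  have "x - proj_onto N x \<in> ocomp S"
    using diff_proj_onto[OF N, of x] S by (auto simp: ocomp_def)
  then have "x = proj_onto N x" using o by fastforce
  then show ?thesis using proj_onto_in[OF N] by metis
qed

lemma riesz_representation:
  fixes f :: "'a::complex_hilbert_space \<Rightarrow> complex"
  assumes f: "bounded_linear f" and sc: "\<And>c x. f (scaleC c x) = c * f x"
  shows "\<exists>z. \<forall>x. f x = cinner x z"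
proof (cases "\<forall>x. f x = 0")
  case True
  then show ?thesis by (intro exI[of _ 0]) simp
next
  case False
  then obtain u where u: "f u \<noteq> 0" by blast
  interpret bounded_linear f by (rule f)
  define N where "N = {x. f x = 0}"
  have N: "csubspace N" "closed N"
    unfolding N_def csubspace_def
    by (auto simp: zero add sc intro!: closed_Collect_eq linear_continuous_on f continuous_intros)
  define w where "w = u - proj_onto N u"
  have wo: "w \<in> ocomp N" unfolding w_def by (rule diff_proj_onto[OF N])
  have "f w = f u" using proj_onto_in[OF N, of u] by (simp add: w_def diff N_def)
  then have fw: "f w \<noteq> 0" using u by simp
  then have w0: "w \<noteq> 0" using zero by auto
  define z where "z = scaleC (cnj (f w) / complex_of_real ((norm w)\<^sup>2)) w"
  have "f x = cinner x z" for x
  proof -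
    \<comment> \<open>Modulo the kernel every vector is a multiple of \<open>w\<close>; pairing with
      \<open>w\<close> recovers the coefficient, which explains the scaling of
      \<open>z\<close>.\<close>
    have "x - scaleC (f x / f w) w \<in> N" using fw by (simp add: N_def diff sc)
    then have "cinner (x - scaleC (f x / f w) w) w = 0"
      using wo by (auto simp: ocomp_def cinner_eq_0_commute)
    then have "cinner x w = f x / f w * complex_of_real ((norm w)\<^sup>2)"
      by (simp add: cinner_simps cinner_norm)
    then show ?thesis using fw w0 by (simp add: z_def cinner_simps)
  qed
  then show ?thesis by blast
qed

text \<open>\<open>adj\<close> is a definite description and says nothing before existence is known;
  the Riesz representation of \<open>x \<mapsto> cinner (T x) y\<close> supplies it.\<close>

lemma exists_adjoint:
  fixes T :: "'h::complex_hilbert_space \<Rightarrow>\<^sub>L 'h"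
  assumes T: "T \<in> bounded_ops"
  shows "\<exists>S. \<forall>x y. cinner (T x) y = cinner x (blinfun_apply S y)"
proof -
  have "\<exists>z. \<forall>x. cinner (T x) y = cinner x z" for y
  proof (rule riesz_representation)
    show "bounded_linear (\<lambda>x. cinner (T x) y)"
      by (rule bounded_linear_compose[OF bounded_linear_cinner_left blinfun.bounded_linear_right])
    show "cinner (T (scaleC c x)) y = c * cinner (T x) y" for c x
      using T by (simp add: bounded_ops_def cinner_simps)
  qed
  then obtain s where s: "\<And>x y. cinner (T x) y = cinner x (s y)" by metis
  have "bounded_linear s"
  proof (rule bounded_linear_intro[where K = "norm T"])
    show "s (x + y) = s x + s y" for x y
      by (rule cinner_ext_right) (simp add: s[symmetric] cinner_simps)
    show "s (r *\<^sub>R x) = r *\<^sub>R s x" for r x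
      by (rule cinner_ext_right) (simp add: s[symmetric] cinner_scaleR_right)
    show "norm (s x) \<le> norm x * norm T" for x
    proof (cases "s x = 0")
      case False
      have "(norm (s x))\<^sup>2 = cmod (cinner (T (s x)) x)"
        by (simp add: s cinner_norm norm_power)
      also have "\<dots> \<le> norm (T (s x)) * norm x" by (rule cinner_Cauchy_Schwarz)
      also have "\<dots> \<le> norm T * norm (s x) * norm x"
        by (intro mult_right_mono norm_blinfun) auto
      finally show ?thesis using False by (simp add: power2_eq_square mult.commute)
    qed simp
  qed
  then have "blinfun_apply (Blinfun s) = s" by (rule bounded_linear_Blinfun_apply)
  then show ?thesis using s by (intro exI[of _ "Blinfun s"]) simp
qed

lemma cinner_adj:
  assumes T: "T \<in> bounded_ops"
  shows "cinner (blinfun_apply T x) y = cinner x (blinfun_apply (adj T) y)"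
proof -
  obtain S where S: "\<forall>x y. cinner (blinfun_apply T x) y = cinner x (blinfun_apply S y)"
    using exists_adjoint[OF T] by blast
  have "S' = S" if "\<forall>x y. cinner (blinfun_apply T x) y = cinner x (blinfun_apply S' y)" for S'
    by (rule blinfun_eqI, rule cinner_ext_right) (use S that in metis)
  then have "adj T = S" unfolding adj_def using S by (intro the_equality) auto
  then show ?thesis using S by simp
qed

lemma adj_eqI:
  assumes "\<And>x y. cinner (blinfun_apply T x) y = cinner x (blinfun_apply S y)"
    and "T \<in> bounded_ops"
  shows "adj T = S"
  by (rule blinfun_eqI, rule cinner_ext_right) (metis assms cinner_adj)

lemma cinner_adj': "T \<in> bounded_ops \<Longrightarrow> cinner (adj T x) y = cinner x (blinfun_apply T y)"
  by (metis cinner_adj cinner_commute)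

lemma adj_bounded_ops:
  assumes T: "T \<in> bounded_ops"
  shows "adj T \<in> bounded_ops"
  unfolding bounded_ops_def mem_Collect_eq
proof (intro allI)
  fix c x
  show "adj T (scaleC c x) = scaleC c (adj T x)"
    by (rule cinner_ext) (simp add: cinner_adj'[OF T] cinner_simps)
qed

lemma adj_adj: "T \<in> bounded_ops \<Longrightarrow> adj (adj T) = T"
  by (rule adj_eqI) (simp_all add: cinner_adj' adj_bounded_ops)

section \<open>Elements of a von Neumann algebra\<close>

lemma bounded_ops_scaleC: "T \<in> bounded_ops \<Longrightarrow> blinfun_apply T (scaleC c x) = scaleC c (blinfun_apply T x)"
  by (simp add: bounded_ops_def)

lemma csubspace_kernel:
  assumes "T \<in> bounded_ops"
  shows "csubspace {x. blinfun_apply T x = 0}" and "closed {x. blinfun_apply T x = 0}"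
proof -
  show "csubspace {x. blinfun_apply T x = 0}"
    using assms by (auto simp: csubspace_def bounded_ops_scaleC blinfun.add_right blinfun.zero_right)
  show "closed {x. blinfun_apply T x = 0}"
    by (intro closed_Collect_eq linear_continuous_on blinfun.bounded_linear_right continuous_intros)
qed

text \<open>The set of points of strong convergence of a sequence of contractions is a closed subspace,
  so it suffices to check a total set.\<close>

lemma strong_convergence_on_total_set:
  fixes T :: "nat \<Rightarrow> 'h::complex_hilbert_space \<Rightarrow>\<^sub>L 'h" and S :: "'h \<Rightarrow>\<^sub>L 'h"
  assumes T: "\<And>n. T n \<in> bounded_ops" "\<And>n x. norm (T n x) \<le> norm x" and S: "S \<in> bounded_ops"
    and A: "\<And>x. x \<in> A \<Longrightarrow> (\<lambda>n. T n x) \<longlonglongrightarrow> S x" and total: "\<And>x. x \<in> ocomp A \<Longrightarrow> x = 0"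
  shows "(\<lambda>n. T n x) \<longlonglongrightarrow> S x"
proof -
  define N where "N = {x. (\<lambda>n. T n x) \<longlonglongrightarrow> S x}"
  have cs: "csubspace N"
    unfolding csubspace_def N_def
    by (auto simp: blinfun.add_right blinfun.zero_right bounded_ops_scaleC[OF T(1)] bounded_ops_scaleC[OF S]
        intro: tendsto_add bounded_linear.tendsto[OF bounded_linear_scaleC])
  have "closed N"
    unfolding closed_sequential_limits
  proof (intro allI impI, elim conjE)
    fix u l assume u: "\<forall>k. u k \<in> N" and ul: "u \<longlonglongrightarrow> l"
    show "l \<in> N" unfolding N_def mem_Collect_eq
    proof (rule metric_LIMSEQ_I)
      fix e :: real assume e: "e > 0"
      \<comment> \<open>The weights of the errors: one for the convergence at \<open>u k\<close>,
        and \<open>norm S + 1\<close> for replacing \<open>u k\<close> by \<open>l\<close> under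
        \<open>S\<close> and under the contraction \<open>T n\<close>.\<close>
      define C where "C = norm S + 2"
      have C: "C > 0" by (simp add: C_def add_nonneg_pos)
      obtain k where k: "norm (u k - l) < e / C"
        using metric_LIMSEQ_D[OF ul, of "e / C"] e C by (auto simp: dist_norm)
      obtain n0 where n0: "\<And>n. n \<ge> n0 \<Longrightarrow> norm (T n (u k) - S (u k)) < e / C"
        using metric_LIMSEQ_D[of "\<lambda>n. T n (u k)" "S (u k)" "e / C"] u e C
        by (auto simp: dist_norm N_def)
      have "norm (T n l - S l) < e" if "n \<ge> n0" for n
      proof -
        have "T n l - S l = (T n (u k) - S (u k)) + (S (u k - l) - T n (u k - l))"
          by (simp add: blinfun.diff_right)
        then have "norm (T n l - S l) \<le> norm (T n (u k) - S (u k)) + norm (S (u k - l) - T n (u k - l))"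
          by (metis norm_triangle_ineq)
        also have "\<dots> \<le> norm (T n (u k) - S (u k)) + (norm S * norm (u k - l) + norm (u k - l))"
          using norm_triangle_ineq4[of "S (u k - l)" "T n (u k - l)"]
            norm_blinfun[of S "u k - l"] T(2)[of n "u k - l"] by linarith
        also have "\<dots> < e / C + (norm S + 1) * (e / C)"
          using n0[OF that] mult_left_mono[OF less_imp_le[OF k], of "norm S + 1", OF add_nonneg_nonneg]
          unfolding distrib_right mult_1 by auto
        also have "\<dots> = C * (e / C)"
        proof -
          have "t + (s + 1) * t = (s + 2) * t" for s t :: real by (simp add: algebra_simps)
          then show ?thesis by (simp only: C_def)
        qed
        also have "\<dots> = e" using C by simp
        finally show ?thesis .
      qed
      then show "\<exists>no. \<forall>n\<ge>no. dist (T n l) (S l) < e" by (auto simp: dist_norm)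
    qed
  qed
  then have "x \<in> N" using closed_csubspace_eq_UNIV[OF cs _ _ total, where x = x] A by (auto simp: N_def)
  then show ?thesis by (simp add: N_def)
qed

locale vn_algebra =
  fixes M :: "('h::complex_hilbert_space \<Rightarrow>\<^sub>L 'h) set"
  assumes vN: "von_neumann_algebra M"
begin

lemma M_bounded_ops: "T \<in> M \<Longrightarrow> T \<in> bounded_ops"
  using vN by (auto simp: von_neumann_algebra_def)

lemma M_scaleC: "T \<in> M \<Longrightarrow> blinfun_apply T (scaleC c x) = scaleC c (blinfun_apply T x)"
  by (simp add: bounded_ops_scaleC M_bounded_ops)

lemma M_commute:
  assumes "T \<in> M" "y \<in> commutant M"
  shows "blinfun_apply y (blinfun_apply T x) = blinfun_apply T (blinfun_apply y x)"
proof -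
  have "T o\<^sub>L y = y o\<^sub>L T" using assms by (simp add: commutant_def)
  then show ?thesis by (metis blinfun_apply_blinfun_compose)
qed

text \<open>The double commutant property is always used in this form: membership becomes
  commutation with the commutant, which can be checked vector by vector.\<close>

lemma in_M_I:
  assumes "T \<in> bounded_ops"
    and "\<And>y x. y \<in> commutant M \<Longrightarrow> blinfun_apply y (blinfun_apply T x) = blinfun_apply T (blinfun_apply y x)"
  shows "T \<in> M"
proof -
  have "T \<in> commutant (commutant M)"
    unfolding commutant_def[of "commutant M"] using assms by (auto intro!: blinfun_eqI)
  then show ?thesis using vN by (simp add: von_neumann_algebra_def)
qed

lemma adj_M: "T \<in> M \<Longrightarrow> adj T \<in> M"
  using vN by (auto simp: von_neumann_algebra_def)

lemma cinner_adj_M: "T \<in> M \<Longrightarrow> cinner (blinfun_apply T x) y = cinner x (blinfun_apply (adj T) y)"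
  by (simp add: cinner_adj M_bounded_ops)

lemma cinner_adj_M': "T \<in> M \<Longrightarrow> cinner (blinfun_apply (adj T) x) y = cinner x (blinfun_apply T y)"
  by (simp add: cinner_adj' M_bounded_ops)

lemma adj_commutant:
  assumes y: "y \<in> commutant M"
  shows "adj y \<in> commutant M"
proof -
  have b: "y \<in> bounded_ops" using y by (simp add: commutant_def)
  have "x o\<^sub>L adj y = adj y o\<^sub>L x" if x: "x \<in> M" for x
  proof (rule blinfun_eqI, rule cinner_ext)
    fix i z
    show "cinner ((x o\<^sub>L adj y) i) z = cinner ((adj y o\<^sub>L x) i) z"
      by (simp add: cinner_adj_M[OF x] cinner_adj'[OF b] M_commute[OF adj_M[OF x] y])
  qed
  then show ?thesis using adj_bounded_ops[OF b] unfolding commutant_def[of M] by blast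
qed

lemma norm_adj_le:
  assumes "T \<in> M"
  shows "norm (adj T) \<le> norm T"
proof (rule norm_blinfun_bound)
  fix y
  show "norm (adj T y) \<le> norm T * norm y"
  proof (cases "adj T y = 0")
    case False
    have "(norm (adj T y))\<^sup>2 = cmod (cinner (T (adj T y)) y)"
      using assms by (simp add: cinner_adj_M cinner_norm norm_power)
    also have "\<dots> \<le> norm (T (adj T y)) * norm y" by (rule cinner_Cauchy_Schwarz)
    also have "\<dots> \<le> norm T * norm (adj T y) * norm y"
      by (intro mult_right_mono norm_blinfun) auto
    finally show ?thesis using False by (simp add: power2_eq_square mult.commute)
  qed simp
qed simp

lemma zero_M: "0 \<in> M"
  by (rule in_M_I) (simp_all add: bounded_ops_def blinfun.zero_right)

lemma id_M: "id_blinfun \<in> M"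
  by (rule in_M_I) (simp_all add: bounded_ops_def)

lemma add_M:
  assumes "S \<in> M" "T \<in> M"
  shows "S + T \<in> M"
  by (rule in_M_I) (simp_all add: bounded_ops_def M_scaleC blinfun.add_left blinfun.add_right
      scaleC_add_right M_commute[OF assms(1)] M_commute[OF assms(2)] assms)

lemma diff_M:
  assumes "S \<in> M" "T \<in> M"
  shows "S - T \<in> M"
  by (rule in_M_I) (simp_all add: bounded_ops_def M_scaleC blinfun.diff_left blinfun.diff_right
      scaleC_diff_right M_commute[OF assms(1)] M_commute[OF assms(2)] assms)

lemma scaleR_M:
  assumes "T \<in> M"
  shows "r *\<^sub>R T \<in> M"
  by (rule in_M_I) (simp_all add: bounded_ops_def M_scaleC blinfun.scaleR_left blinfun.scaleR_right
      scaleC_scaleR M_commute[OF assms] assms)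

lemma compose_M:
  assumes "S \<in> M" "T \<in> M"
  shows "S o\<^sub>L T \<in> M"
  by (rule in_M_I) (simp_all add: bounded_ops_def M_scaleC M_commute[OF assms(1)] M_commute[OF assms(2)] assms)

lemma limit_M:
  assumes T: "\<And>n. T n \<in> M" and l: "T \<longlonglongrightarrow> S"
  shows "S \<in> M"
proof (rule in_M_I)
  have lim: "(\<lambda>n. T n x) \<longlonglongrightarrow> S x" for x
    by (rule bounded_linear.tendsto[OF blinfun.bounded_linear_left l])
  have "S (scaleC c x) = scaleC c (S x)" for c x
  proof (rule LIMSEQ_unique[OF lim])
    show "(\<lambda>n. T n (scaleC c x)) \<longlonglongrightarrow> scaleC c (S x)"
      using bounded_linear.tendsto[OF bounded_linear_scaleC lim, of c x] T by (simp add: M_scaleC)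
  qed
  then show "S \<in> bounded_ops" by (simp add: bounded_ops_def)
  fix y x assume y: "y \<in> commutant M"
  show "y (S x) = S (y x)"
  proof (rule LIMSEQ_unique[OF _ lim])
    show "(\<lambda>n. T n (y x)) \<longlonglongrightarrow> y (S x)"
      using bounded_linear.tendsto[OF blinfun.bounded_linear_right lim, of y x] M_commute[OF T y]
      by simp
  qed
qed

text \<open>The remainder \<open>x - proj_onto N x\<close> stays orthogonal to \<open>N\<close>
  under \<open>y\<close>, because \<open>adj y\<close> again lies in the commutant and preserves
  \<open>N\<close>. Uniqueness of the orthogonal decomposition then gives commutation.\<close>

lemma proj_onto_M:
  assumes N: "csubspace N" "closed N"
    and inv: "\<And>y x. y \<in> commutant M \<Longrightarrow> x \<in> N \<Longrightarrow> blinfun_apply y x \<in> N"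
  shows "proj_onto N \<in> M"
proof (rule in_M_I)
  show "proj_onto N \<in> bounded_ops" by (rule proj_onto_in_bounded_ops[OF N])
  fix y x assume y: "y \<in> commutant M"
  have b: "y \<in> bounded_ops" using y by (simp add: commutant_def)
  have "cinner (y (x - proj_onto N x)) z = 0" if "z \<in> N" for z
  proof -
    have "adj y z \<in> N" using inv adj_commutant[OF y] that by blast
    then show ?thesis using diff_proj_onto[OF N, of x] by (simp add: ocomp_def cinner_adj[OF b])
  qed
  then have "y x - y (proj_onto N x) \<in> ocomp N" by (simp add: ocomp_def blinfun.diff_right)
  then show "y (proj_onto N x) = proj_onto N (y x)"
    using proj_onto_eqI[OF N] inv[OF y proj_onto_in[OF N]] by metis
qed

section \<open>The projections of a von Neumann algebra\<close>

lemma projection_M: "e \<in> projections M \<Longrightarrow> e \<in> M"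
  by (simp add: projections_def)

lemma projection_idem: "e \<in> projections M \<Longrightarrow> blinfun_apply e (blinfun_apply e x) = blinfun_apply e x"
  unfolding projections_def by (metis (mono_tags, lifting) blinfun_apply_blinfun_compose mem_Collect_eq)

lemma projection_selfadjoint:
  "e \<in> projections M \<Longrightarrow> cinner (blinfun_apply e x) y = cinner x (blinfun_apply e y)"
  unfolding projections_def using cinner_adj_M[of e x y] by simp

lemma projectionI:
  assumes "e \<in> M" "\<And>x. blinfun_apply e (blinfun_apply e x) = blinfun_apply e x"
    "\<And>x y. cinner (blinfun_apply e x) y = cinner x (blinfun_apply e y)"
  shows "e \<in> projections M"
  using assms adj_eqI[of e e] by (auto simp: projections_def M_bounded_ops intro: blinfun_eqI)

lemma cinner_projection:
  assumes "e \<in> projections M"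
  shows "cinner (blinfun_apply e x) x = complex_of_real ((norm (blinfun_apply e x))\<^sup>2)"
  by (metis assms cinner_norm projection_idem projection_selfadjoint)

lemma norm_projection_le:
  assumes e: "e \<in> projections M"
  shows "norm (blinfun_apply e x) \<le> norm x"
proof (cases "e x = 0")
  case False
  have "(norm (e x))\<^sup>2 \<le> norm (e x) * norm x"
    using cinner_Cauchy_Schwarz[of "e x" x] by (simp only: cinner_projection[OF e]) (simp add: norm_power)
  then show ?thesis using False by (simp add: power2_eq_square)
qed simp

lemma perp_apply [simp]: "blinfun_apply (perp e) x = x - blinfun_apply e x"
  by (simp add: perp_def blinfun.diff_left)

lemma perp_projection: "e \<in> projections M \<Longrightarrow> perp e \<in> projections M"
  by (rule projectionI) (auto simp: perp_def blinfun.diff_left blinfun.diff_right projection_idem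
      projection_selfadjoint cinner_simps id_M diff_M projection_M)

lemma perp_perp [simp]: "perp (perp e) = e"
  by (simp add: perp_def)

lemma id_projection: "id_blinfun \<in> projections M"
  by (rule projectionI) (auto simp: id_M)

lemma proj_onto_projection:
  assumes N: "csubspace N" "closed N"
    and inv: "\<And>y x. y \<in> commutant M \<Longrightarrow> x \<in> N \<Longrightarrow> blinfun_apply y x \<in> N"
  shows "proj_onto N \<in> projections M"
  by (rule projectionI) (use assms in \<open>auto intro: proj_onto_M proj_onto_in proj_onto_ident
      proj_onto_selfadjoint\<close>)

text \<open>The meet in the lattice of projections: the range of a projection is its fixed space, so
  the set is the intersection of the ranges.\<close>

definition proj_inf :: "('h \<Rightarrow>\<^sub>L 'h) set \<Rightarrow> 'h \<Rightarrow>\<^sub>L 'h" where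
  "proj_inf E = proj_onto {x. \<forall>e\<in>E. blinfun_apply e x = x}"

lemma
  assumes E: "E \<subseteq> projections M"
  shows proj_inf_projection: "proj_inf E \<in> projections M"
    and proj_inf_fixed: "e \<in> E \<Longrightarrow> blinfun_apply e (blinfun_apply (proj_inf E) x) = blinfun_apply (proj_inf E) x"
    and proj_inf_greatest: "(\<And>e. e \<in> E \<Longrightarrow> blinfun_apply e x = x) \<Longrightarrow> blinfun_apply (proj_inf E) x = x"
proof -
  let ?N = "{x. \<forall>e\<in>E. blinfun_apply e x = x}"
  have M: "e \<in> M" if "e \<in> E" for e using that E projection_M by blast
  have cs: "csubspace ?N"
    using M by (auto simp: csubspace_def blinfun.zero_right blinfun.add_right M_scaleC)
  have eq: "?N = (\<Inter>e\<in>E. {x. blinfun_apply e x = x})" by auto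
  have cl: "closed ?N"
    unfolding eq by (intro closed_INT ballI closed_Collect_eq linear_continuous_on
        blinfun.bounded_linear_right continuous_intros)
  show "proj_inf E \<in> projections M" unfolding proj_inf_def
    by (rule proj_onto_projection[OF cs cl]) (auto simp: M_commute[OF M, symmetric])
  show "blinfun_apply e (blinfun_apply (proj_inf E) x) = blinfun_apply (proj_inf E) x" if "e \<in> E"
    using proj_onto_in[OF cs cl, of x] that by (auto simp: proj_inf_def)
  show "blinfun_apply (proj_inf E) x = x" if "\<And>e. e \<in> E \<Longrightarrow> blinfun_apply e x = x"
    unfolding proj_inf_def by (rule proj_onto_ident[OF cs cl]) (use that in auto)
qed

text \<open>Tested on the kernels of the \<open>F n\<close> and on the vectors fixed by all of them.
  On a kernel the sequence is eventually zero. A vector orthogonal to both sets is orthogonal to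
  each \<open>x - F n x\<close>, hence fixed by every \<open>F n\<close>, hence orthogonal to
  itself.\<close>

lemma projection_decreasing_limit:
  fixes F :: "nat \<Rightarrow> 'h \<Rightarrow>\<^sub>L 'h"
  assumes F: "\<And>n. F n \<in> projections M" and dec: "\<And>m n x. n \<le> m \<Longrightarrow> F m x = x \<Longrightarrow> F n x = x"
  shows "(\<lambda>n. F n x) \<longlonglongrightarrow> proj_inf (range F) x"
proof -
  let ?P = "proj_inf (range F)"
  have P: "?P \<in> projections M" using F by (intro proj_inf_projection) auto
  show ?thesis
  proof (rule strong_convergence_on_total_set[where A = "{x. \<exists>n. F n x = 0} \<union> {x. \<forall>n. F n x = x}"])
    fix x assume x: "x \<in> {x. \<exists>n. F n x = 0} \<union> {x. \<forall>n. F n x = x}"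
    show "(\<lambda>n. F n x) \<longlonglongrightarrow> ?P x"
    proof (cases "\<forall>n. F n x = x")
      case True
      then have "?P x = x" using F by (intro proj_inf_greatest) auto
      then show ?thesis using True by simp
    next
      case False
      then obtain n where n: "F n x = 0" using x by blast
      have 0: "e x = 0" if e: "e \<in> projections M" and le: "\<And>z. e z = z \<Longrightarrow> F n z = z" for e :: "'h \<Rightarrow>\<^sub>L 'h"
      proof -
        have "cinner (e x) (e x) = cinner x (e x)"
          by (metis e projection_idem projection_selfadjoint)
        also have "\<dots> = cinner x (F n (e x))" using le e projection_idem by simp
        also have "\<dots> = cinner (F n x) (e x)" by (simp add: F projection_selfadjoint)
        finally show ?thesis using n by simp
      qed
      have "F m x = 0" if "m \<ge> n" for m
        by (rule 0[OF F]) (use dec that in blast)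
      moreover have "?P x = 0"
        by (rule 0[OF P]) (metis F image_subset_iff proj_inf_fixed rangeI)
      ultimately show ?thesis
        by (intro tendsto_eventually) (auto simp: eventually_sequentially)
    qed
  next
    fix x assume x: "x \<in> ocomp ({x. \<exists>n. F n x = 0} \<union> {x. \<forall>n. F n x = x})"
    have "F n x = x" for n
    proof -
      have "F n (x - F n x) = 0" by (simp add: blinfun.diff_right projection_idem F)
      then have "cinner x (x - F n x) = 0" using x by (auto simp: ocomp_def)
      moreover have "cinner (F n x) (x - F n x) = 0"
        using F[of n] by (simp add: projection_selfadjoint blinfun.diff_right projection_idem)
      ultimately have "cinner (x - F n x) (x - F n x) = 0" by (simp add: cinner_diff_left)
      then show ?thesis by simp
    qed
    then have "cinner x x = 0" using x by (auto simp: ocomp_def)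
    then show "x = 0" by simp
  qed (use F P in \<open>auto simp: M_bounded_ops projection_M norm_projection_le\<close>)
qed

text \<open>The vectors fixed by some \<open>F n\<close> form a total set, on which the sequence is
  eventually constant. The hypothesis \<open>total\<close> expresses that the supremum of the
  \<open>F n\<close> is 1.\<close>

lemma projection_increasing_limit:
  fixes F :: "nat \<Rightarrow> 'h \<Rightarrow>\<^sub>L 'h"
  assumes F: "\<And>n. F n \<in> projections M" and inc: "\<And>m n x. m \<le> n \<Longrightarrow> F m x = x \<Longrightarrow> F n x = x"
    and total: "\<And>x. (\<And>n. F n x = 0) \<Longrightarrow> x = 0"
  shows "(\<lambda>n. F n x) \<longlonglongrightarrow> x"
proof -
  have "(\<lambda>n. F n x) \<longlonglongrightarrow> id_blinfun x"
  proof (rule strong_convergence_on_total_set[where A = "{x. \<exists>n. F n x = x}"])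
    fix x assume "x \<in> {x. \<exists>n. F n x = x}"
    then obtain n where "F n x = x" by blast
    then have "\<And>m. m \<ge> n \<Longrightarrow> F m x = x" using inc by blast
    then show "(\<lambda>n. F n x) \<longlonglongrightarrow> id_blinfun x"
      by (intro tendsto_eventually) (auto simp: eventually_sequentially)
  next
    fix x assume x: "x \<in> ocomp {x. \<exists>n. F n x = x}"
    show "x = 0"
    proof (rule total)
      fix n
      have "cinner x (F n x) = 0" using x projection_idem[OF F] by (auto simp: ocomp_def)
      then show "F n x = 0"
        by (metis F cinner_eq_0_commute cinner_projection cinner_norm cinner_self_eq_0)
    qed
  qed (use F id_M in \<open>auto simp: M_bounded_ops projection_M norm_projection_le\<close>)
  then show ?thesis by simp
qed

text \<open>The right support, the projection onto the complement of the kernel. The left support is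
  written \<open>supp (adj T)\<close>.\<close>

definition supp :: "('h \<Rightarrow>\<^sub>L 'h) \<Rightarrow> 'h \<Rightarrow>\<^sub>L 'h" where
  "supp T = perp (proj_onto {x. blinfun_apply T x = 0})"

lemma
  assumes T: "T \<in> M"
  shows supp_projection: "supp T \<in> projections M"
    and supp_eq_0_iff: "blinfun_apply (supp T) x = 0 \<longleftrightarrow> blinfun_apply T x = 0"
    and apply_supp: "blinfun_apply T (blinfun_apply (supp T) x) = blinfun_apply T x"
proof -
  note k = csubspace_kernel[OF M_bounded_ops[OF T]]
  show "supp T \<in> projections M"
    unfolding supp_def
    by (intro perp_projection proj_onto_projection k) (use M_commute[OF T, symmetric] in \<open>auto simp: blinfun.zero_right\<close>)
  show "blinfun_apply (supp T) x = 0 \<longleftrightarrow> blinfun_apply T x = 0"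
    using proj_onto_in[OF k, of x] proj_onto_ident[OF k, of x] by (auto simp: supp_def)
  show "blinfun_apply T (blinfun_apply (supp T) x) = blinfun_apply T x"
    using proj_onto_in[OF k, of x] by (auto simp: supp_def blinfun.diff_right)
qed

end

section \<open>Traces of projections\<close>

text \<open>The adjoint of the identity \<open>e h = h\<close>: the relation
  \<open>h \<le> e\<close> can be used on either side.\<close>

lemma (in vn_algebra) projection_absorb:
  assumes e: "e \<in> projections M" and h: "h \<in> projections M"
    and "\<And>z. blinfun_apply e (blinfun_apply h z) = blinfun_apply h z"
  shows "blinfun_apply h (blinfun_apply e z) = blinfun_apply h z"
  by (rule cinner_ext) (simp add: projection_selfadjoint[OF e] projection_selfadjoint[OF h] assms(3))

text \<open>With \<open>a = x\<^sup>* x\<close>, the recursion \<open>r (n + 1) = r n - a (r n)\<^sup>2\<close> decreases to the indicator of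
  \<open>a = 0\<close> when \<open>0 \<le> a \<le> 1\<close>. Each increment is the product of an operator with its adjoint, so that
  the trace property applies to it and no functional calculus is needed.\<close>

primrec kernel_approx :: "('h::complex_hilbert_space \<Rightarrow>\<^sub>L 'h) \<Rightarrow> nat \<Rightarrow> 'h \<Rightarrow>\<^sub>L 'h" where
  "kernel_approx T 0 = id_blinfun"
| "kernel_approx T (Suc n) =
     kernel_approx T n - (kernel_approx T n o\<^sub>L (adj T o\<^sub>L (T o\<^sub>L kernel_approx T n)))"

lemma norm_sq_le_quadratic_form:
  fixes V :: "'h::complex_hilbert_space \<Rightarrow>\<^sub>L 'h"
  assumes sa: "\<And>x y. cinner (V x) y = cinner x (V y)"
    and pos: "\<And>x. 0 \<le> Re (cinner (V x) x)" and le: "\<And>x. Re (cinner (V x) x) \<le> (norm x)\<^sup>2"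
  shows "(norm (V x))\<^sup>2 \<le> Re (cinner (V x) x)"
proof -
  \<comment> \<open>\<open>V - V\<^sup>2 = V (1 - V) V + (1 - V) V (1 - V)\<close>\<close>
  let ?u = "V x"
  have "Re (cinner (V (x - ?u)) (x - ?u)) = Re (cinner ?u x) - 2 * (norm ?u)\<^sup>2 + Re (cinner (V ?u) ?u)"
    by (simp add: blinfun.diff_right cinner_simps sa norm_sq_cinner)
  then show ?thesis using pos[of "x - ?u"] le[of ?u] by linarith
qed

context vn_algebra
begin

lemma kernel_approx_M: "T \<in> M \<Longrightarrow> kernel_approx T n \<in> M"
  by (induction n) (auto intro: id_M diff_M compose_M adj_M)

lemma kernel_approx_selfadjoint:
  assumes "T \<in> M"
  shows "cinner (kernel_approx T n x) y = cinner x (kernel_approx T n y)"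
  using assms
  by (induction n arbitrary: x y)
    (simp_all add: blinfun.diff_left cinner_simps cinner_adj_M cinner_adj_M')

text \<open>One step lowers the quadratic form by a square. This yields monotonicity in
  \<open>n\<close>, and telescoping yields convergence.\<close>

lemma kernel_approx_Suc_form:
  assumes "T \<in> M"
  shows "Re (cinner (kernel_approx T (Suc n) x) x)
    = Re (cinner (kernel_approx T n x) x) - (norm (T (kernel_approx T n x)))\<^sup>2"
  using assms
  by (simp add: blinfun.diff_left cinner_simps kernel_approx_selfadjoint cinner_adj_M' norm_sq_cinner)

text \<open>The induction carries \<open>R^2 \<le> R\<close> for
  \<open>R = kernel_approx T n\<close>. By Cauchy-Schwarz it makes \<open>R\<close> a contraction,
  and since \<open>norm T \<le> 1\<close> the square subtracted in the next step is at most the form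
  of \<open>R\<close>. The next operator thus lies between 0 and 1, so that
  \<open>norm_sq_le_quadratic_form\<close> restores the invariant.\<close>

lemma kernel_approx_bounds:
  assumes T: "T \<in> M" "norm T \<le> 1"
  shows "(norm (kernel_approx T n x))\<^sup>2 \<le> Re (cinner (kernel_approx T n x) x)"
    and "norm (kernel_approx T n x) \<le> norm x"
    and "Re (cinner (kernel_approx T n x) x) \<le> (norm x)\<^sup>2"
proof -
  have contr: "norm (V x) \<le> norm x \<and> Re (cinner (V x) x) \<le> (norm x)\<^sup>2"
    if "(norm (V x))\<^sup>2 \<le> Re (cinner (V x) x)" for V :: "'h \<Rightarrow>\<^sub>L 'h" and x
  proof -
    have cs: "Re (cinner (V x) x) \<le> norm (V x) * norm x"
      using complex_Re_le_cmod cinner_Cauchy_Schwarz order_trans by blast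
    have 1: "norm (V x) \<le> norm x"
    proof (cases "V x = 0")
      case False
      have "norm (V x) * norm (V x) \<le> norm (V x) * norm x"
        using cs that by (simp add: power2_eq_square)
      then show ?thesis using False by simp
    qed simp
    then have "norm (V x) * norm x \<le> norm x * norm x" by (intro mult_right_mono) auto
    then show ?thesis using 1 cs by (simp add: power2_eq_square)
  qed
  have main: "(norm (kernel_approx T n x))\<^sup>2 \<le> Re (cinner (kernel_approx T n x) x)" for x
  proof (induction n arbitrary: x)
    case 0
    then show ?case by (simp add: norm_sq_cinner)
  next
    case (Suc n)
    note c = contr[OF Suc]
    show ?case
    proof (rule norm_sq_le_quadratic_form)
      show "cinner (kernel_approx T (Suc n) x) y = cinner x (kernel_approx T (Suc n) y)" for x y
        by (rule kernel_approx_selfadjoint[OF T(1)])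
      fix x
      have "norm (T (kernel_approx T n x)) \<le> norm (kernel_approx T n x)"
        using norm_blinfun[of T "kernel_approx T n x"] mult_right_mono[OF T(2), of "norm (kernel_approx T n x)"]
        by simp
      then have "(norm (T (kernel_approx T n x)))\<^sup>2 \<le> (norm (kernel_approx T n x))\<^sup>2"
        by (simp add: power_mono)
      then show "0 \<le> Re (cinner (kernel_approx T (Suc n) x) x)"
        unfolding kernel_approx_Suc_form[OF T(1)] using Suc[of x] by linarith
      show "Re (cinner (kernel_approx T (Suc n) x) x) \<le> (norm x)\<^sup>2"
        unfolding kernel_approx_Suc_form[OF T(1)] using c[of x] by (smt (verit) zero_le_power2)
    qed
  qed
  then show "(norm (kernel_approx T n x))\<^sup>2 \<le> Re (cinner (kernel_approx T n x) x)" .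
  show "norm (kernel_approx T n x) \<le> norm x" "Re (cinner (kernel_approx T n x) x) \<le> (norm x)\<^sup>2"
    using contr[OF main] by auto
qed

text \<open>\<open>kernel_approx T n\<close> is a polynomial in \<open>adj T o\<^sub>L T\<close>,
  and moving \<open>T\<close> across it turns it into the same polynomial in
  \<open>T o\<^sub>L adj T\<close>.\<close>

lemma kernel_approx_intertwine:
  assumes "T \<in> M"
  shows "T (kernel_approx T n x) = kernel_approx (adj T) n (T x)"
proof (induction n arbitrary: x)
  case (Suc n)
  then show ?case
    using assms by (simp add: blinfun.diff_left blinfun.diff_right adj_adj M_bounded_ops)
qed simp

text \<open>The kernel of \<open>T\<close> and the range of \<open>adj T\<close> together are total.
  The kernel is fixed. For \<open>x = adj T y\<close>, intertwining makes the squared norm of the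
  \<open>n\<close>-th approximant at \<open>x\<close> the decrement of the form of
  \<open>kernel_approx (adj T) n\<close> at \<open>y\<close>; these forms decrease and are
  nonnegative, so the decrements vanish.\<close>

lemma kernel_approx_limit:
  assumes T: "T \<in> M" "norm T \<le> 1" "norm (adj T) \<le> 1"
  shows "(\<lambda>n. kernel_approx T n x) \<longlonglongrightarrow> perp (supp T) x"
proof (rule strong_convergence_on_total_set[where A = "{x. T x = 0} \<union> range (blinfun_apply (adj T))"])
  fix x assume "x \<in> {x. T x = 0} \<union> range (blinfun_apply (adj T))"
  then consider "T x = 0" | y where "x = adj T y" by auto
  then show "(\<lambda>n. kernel_approx T n x) \<longlonglongrightarrow> perp (supp T) x"
  proof cases
    case 1
    have "kernel_approx T n x = x" for n
      by (induction n) (simp_all add: 1 blinfun.diff_left blinfun.zero_right)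
    then show ?thesis using 1 supp_eq_0_iff[OF T(1), of x] by simp
  next
    case (2 y)
    have S: "adj T \<in> M" using T adj_M by blast
    let ?S = "\<lambda>n. kernel_approx (adj T) n y"
    let ?c = "\<lambda>n. Re (cinner (?S n) y)"
    have eq: "kernel_approx T n x = adj T (?S n)" for n
      using kernel_approx_intertwine[OF S, of n y] T by (simp add: 2 adj_adj M_bounded_ops)
    have step: "(norm (kernel_approx T n x))\<^sup>2 = ?c n - ?c (Suc n)" for n
      using kernel_approx_Suc_form[OF S, of n y] by (simp only: eq)
    have "decseq ?c"
      using step by (intro decseq_SucI) (metis diff_ge_0_iff_ge zero_le_power2)
    moreover have "0 \<le> ?c n" for n
      using kernel_approx_bounds(1)[OF S T(3), of n y] by (meson order_trans zero_le_power2)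
    ultimately obtain l where l: "?c \<longlonglongrightarrow> l" using decseq_convergent by blast
    have "(\<lambda>n. ?c n - ?c (Suc n)) \<longlonglongrightarrow> l - l"
      by (intro tendsto_diff l LIMSEQ_Suc)
    then have "(\<lambda>n. sqrt ((norm (kernel_approx T n x))\<^sup>2)) \<longlonglongrightarrow> sqrt 0"
      unfolding step[symmetric] by (intro tendsto_real_sqrt) simp
    then have "(\<lambda>n. kernel_approx T n x) \<longlonglongrightarrow> 0" by (simp add: tendsto_norm_zero_iff)
    moreover have "supp T x = x"
    proof (rule cinner_ext)
      fix z
      have "cinner (supp T x) z = cinner y (T (supp T z))"
        using T by (simp add: 2 projection_selfadjoint supp_projection cinner_adj_M')
      then show "cinner (supp T x) z = cinner x z"
        using T by (simp add: 2 apply_supp cinner_adj_M')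
    qed
    ultimately show ?thesis by simp
  qed
next
  fix x assume x: "x \<in> ocomp ({x. T x = 0} \<union> range (blinfun_apply (adj T)))"
  have "cinner (T x) (T x) = cinner x (adj T (T x))" using T by (simp add: cinner_adj_M)
  also have "\<dots> = 0" using x by (auto simp: ocomp_def)
  finally have "T x = 0" by simp
  then have "cinner x x = 0" using x by (auto simp: ocomp_def)
  then show "x = 0" by simp
qed (use T in \<open>auto simp: kernel_approx_M kernel_approx_bounds M_bounded_ops projection_M
      perp_projection supp_projection\<close>)

section \<open>The positive cone and its order in terms of quadratic forms\<close>

lemma positive_coneI:
  assumes "T \<in> M" "\<And>x. cinner (blinfun_apply T x) x = complex_of_real (f x)" "\<And>x. 0 \<le> f x"
  shows "T \<in> positive_cone M"
  using assms by (simp add: positive_cone_def positive_op_def M_bounded_ops)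

lemma positive_coneI_selfadjoint:
  assumes "T \<in> M" "\<And>x y. cinner (blinfun_apply T x) y = cinner x (blinfun_apply T y)"
    "\<And>x. 0 \<le> Re (cinner (blinfun_apply T x) x)"
  shows "T \<in> positive_cone M"
proof (rule positive_coneI[OF assms(1) _ assms(3)])
  fix x
  have "cinner (blinfun_apply T x) x = cnj (cinner (blinfun_apply T x) x)"
    by (metis assms(2) cinner_commute)
  then show "cinner (blinfun_apply T x) x = complex_of_real (Re (cinner (blinfun_apply T x) x))"
    by (metis Reals_cnj_iff of_real_Re)
qed

lemma adj_compose_positive: "T \<in> M \<Longrightarrow> adj T o\<^sub>L T \<in> positive_cone M"
  by (rule positive_coneI[where f = "\<lambda>x. (norm (T x))\<^sup>2"])
    (auto intro: compose_M adj_M simp: cinner_adj_M' cinner_norm)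

lemma projection_positive: "e \<in> projections M \<Longrightarrow> e \<in> positive_cone M"
  by (rule positive_coneI[where f = "\<lambda>x. (norm (e x))\<^sup>2"])
    (auto simp: projection_M cinner_projection)

lemma op_le_iff:
  assumes "S \<in> positive_cone M" "T \<in> positive_cone M"
  shows "op_le S T \<longleftrightarrow> (\<forall>x. Re (cinner (blinfun_apply S x) x) \<le> Re (cinner (blinfun_apply T x) x))"
  using assms diff_M[of T S] M_bounded_ops[of "T - S"]
  by (auto simp: op_le_def positive_op_def positive_cone_def blinfun.diff_left cinner_simps)

end

locale traced_algebra = vn_algebra M
  for M :: "('h::complex_hilbert_space \<Rightarrow>\<^sub>L 'h) set" +
  fixes \<tau> :: "('h \<Rightarrow>\<^sub>L 'h) \<Rightarrow> ennreal"
  assumes fns: "fns_trace M \<tau>"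
begin

lemma trace_add: "S \<in> positive_cone M \<Longrightarrow> T \<in> positive_cone M \<Longrightarrow> \<tau> (S + T) = \<tau> S + \<tau> T"
  using fns by (simp add: fns_trace_def trace_on_def)

lemma trace_adj_compose: "T \<in> M \<Longrightarrow> \<tau> (adj T o\<^sub>L T) = \<tau> (T o\<^sub>L adj T)"
  using fns by (simp add: fns_trace_def trace_on_def)

lemma trace_mono:
  assumes S: "S \<in> positive_cone M" and T: "T \<in> positive_cone M"
    and le: "\<And>x. Re (cinner (blinfun_apply S x) x) \<le> Re (cinner (blinfun_apply T x) x)"
  shows "\<tau> S \<le> \<tau> T"
proof -
  have "positive_op (T - S)" using op_le_iff[OF S T] le by (simp add: op_le_def)
  then have "T - S \<in> positive_cone M" using S T by (simp add: positive_cone_def diff_M)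
  then have "\<tau> (S + (T - S)) = \<tau> S + \<tau> (T - S)" by (rule trace_add[OF S])
  then show ?thesis by simp
qed

text \<open>Inclusion of kernels expresses \<open>e \<le> f\<close>; the order is used in this form
  because supports are described by kernels.\<close>

lemma trace_projection_mono:
  assumes e: "e \<in> projections M" and f: "f \<in> projections M"
    and ker: "\<And>x. blinfun_apply f x = 0 \<Longrightarrow> blinfun_apply e x = 0"
  shows "\<tau> e \<le> \<tau> f"
proof (rule trace_mono)
  fix x
  have "e (x - f x) = 0" by (rule ker) (simp add: blinfun.diff_right projection_idem[OF f])
  then have "e x = e (f x)" by (simp add: blinfun.diff_right)
  then have "norm (e x) \<le> norm (f x)" using norm_projection_le[OF e, of "f x"] by simp
  then show "Re (cinner (blinfun_apply e x) x) \<le> Re (cinner (blinfun_apply f x) x)"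
    by (simp add: cinner_projection[OF e] cinner_projection[OF f] power_mono)
qed (use e f projection_positive in auto)

text \<open>Strong convergence makes the quadratic forms converge, so \<open>s\<close> is the least
  upper bound of the range, which is what normality for directed sets asks for.\<close>

lemma trace_normal_sequence:
  fixes d :: "nat \<Rightarrow> 'h \<Rightarrow>\<^sub>L 'h"
  assumes d: "\<And>n. d n \<in> positive_cone M" and s: "s \<in> positive_cone M"
    and inc: "\<And>n x. Re (cinner (d n x) x) \<le> Re (cinner (d (Suc n) x) x)"
    and lim: "\<And>x. (\<lambda>n. d n x) \<longlonglongrightarrow> s x"
  shows "\<tau> s = (SUP n. \<tau> (d n))"
proof -
  have mono: "Re (cinner (d m x) x) \<le> Re (cinner (d n x) x)" if "m \<le> n" for m n x
    using lift_Suc_mono_le[of "\<lambda>n. Re (cinner (d n x) x)"] inc that by blast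
  have rlim: "(\<lambda>n. Re (cinner (d n x) x)) \<longlonglongrightarrow> Re (cinner (s x) x)" for x
    by (intro tendsto_Re bounded_linear.tendsto[OF bounded_linear_cinner_left] lim)
  have "\<forall>x\<in>range d. \<forall>y\<in>range d. \<exists>z\<in>range d. op_le x z \<and> op_le y z"
  proof (clarsimp)
    fix m n
    have "op_le (d m) (d (max m n)) \<and> op_le (d n) (d (max m n))"
      using mono by (simp add: op_le_iff d)
    then show "\<exists>k. op_le (d m) (d k) \<and> op_le (d n) (d k)" by blast
  qed
  moreover have "\<forall>x\<in>range d. op_le x s"
    using incseq_le[OF _ rlim] mono by (auto simp: op_le_iff d s incseq_def)
  moreover have "\<forall>t\<in>positive_cone M. (\<forall>x\<in>range d. op_le x t) \<longrightarrow> op_le s t"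
    using LIMSEQ_le_const2[OF rlim] by (auto simp: op_le_iff d s)
  moreover have "range d \<subseteq> positive_cone M" "range d \<noteq> {}" using d by auto
  ultimately have "\<tau> s = (SUP x\<in>range d. \<tau> x)"
    using fns s unfolding fns_trace_def normal_trace_def by blast
  then show ?thesis by (simp add: image_image)
qed

text \<open>With \<open>Z = T o\<^sub>L kernel_approx T n\<close>, the increment for
  \<open>T\<close> is \<open>adj Z o\<^sub>L Z\<close>. By intertwining, the corresponding operator
  for \<open>adj T\<close> is \<open>adj Z\<close>, so its increment is
  \<open>Z o\<^sub>L adj Z\<close>, of the same trace.\<close>

lemma trace_kernel_approx:
  assumes T: "T \<in> M" "norm T \<le> 1" "norm (adj T) \<le> 1"
  shows "\<tau> (id_blinfun - kernel_approx T n) = \<tau> (id_blinfun - kernel_approx (adj T) n)"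
proof (induction n)
  case (Suc n)
  let ?S = "adj T"
  have S: "?S \<in> M" and SS: "adj ?S = T" using T by (auto simp: adj_M adj_adj M_bounded_ops)
  define R where "R = kernel_approx T n"
  define Q where "Q = kernel_approx ?S n"
  have R: "R \<in> M" and Q: "Q \<in> M" using T S by (auto simp: R_def Q_def kernel_approx_M)
  have TR: "T o\<^sub>L R \<in> M" and SQ: "?S o\<^sub>L Q \<in> M" using T S R Q by (auto intro: compose_M)
  have "adj (T o\<^sub>L R) = R o\<^sub>L ?S"
    using T by (intro adj_eqI M_bounded_ops[OF TR]) (simp add: cinner_adj_M R_def kernel_approx_selfadjoint)
  moreover have "adj (?S o\<^sub>L Q) = Q o\<^sub>L T"
    using S SS by (intro adj_eqI M_bounded_ops[OF SQ])
      (simp add: cinner_adj_M[OF S] Q_def kernel_approx_selfadjoint[OF S])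
  moreover have "T o\<^sub>L R = Q o\<^sub>L T" "?S o\<^sub>L Q = R o\<^sub>L ?S"
    using kernel_approx_intertwine[OF T(1), of n] kernel_approx_intertwine[OF S, of n]
    by (auto intro!: blinfun_eqI simp: R_def Q_def SS)
  ultimately have a: "adj (T o\<^sub>L R) = ?S o\<^sub>L Q" "adj (?S o\<^sub>L Q) = T o\<^sub>L R" by auto
  have inc: "id_blinfun - kernel_approx V (Suc n)
      = (id_blinfun - kernel_approx V n) + (adj (V o\<^sub>L kernel_approx V n) o\<^sub>L (V o\<^sub>L kernel_approx V n))"
    if V: "V \<in> M" for V
  proof -
    have "adj (V o\<^sub>L kernel_approx V n) = kernel_approx V n o\<^sub>L adj V"
      using V by (intro adj_eqI M_bounded_ops compose_M kernel_approx_M)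
        (simp_all add: cinner_adj_M kernel_approx_selfadjoint)
    then show ?thesis
      by (intro blinfun_eqI) (simp add: blinfun.diff_left blinfun.add_left)
  qed
  have pos: "id_blinfun - kernel_approx V n \<in> positive_cone M" if "V \<in> M" "norm V \<le> 1" for V
    using that kernel_approx_bounds(3)[OF that, of n]
    by (intro positive_coneI_selfadjoint)
      (auto intro: diff_M id_M kernel_approx_M
        simp: blinfun.diff_left cinner_simps kernel_approx_selfadjoint norm_sq_cinner)
  have "\<tau> (id_blinfun - kernel_approx T (Suc n))
      = \<tau> (id_blinfun - R) + \<tau> (adj (T o\<^sub>L R) o\<^sub>L (T o\<^sub>L R))"
    unfolding inc[OF T(1)] R_def
    by (rule trace_add[OF pos[OF T(1,2)] adj_compose_positive]) (use TR in \<open>simp add: R_def\<close>)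
  also have "\<tau> (adj (T o\<^sub>L R) o\<^sub>L (T o\<^sub>L R)) = \<tau> (adj (?S o\<^sub>L Q) o\<^sub>L (?S o\<^sub>L Q))"
    using trace_adj_compose[OF TR] a by simp
  also have "\<tau> (id_blinfun - R) + \<dots> = \<tau> (id_blinfun - kernel_approx ?S (Suc n))"
    unfolding inc[OF S] R_def Suc Q_def
    by (rule trace_add[OF pos[OF S T(3)] adj_compose_positive, symmetric]) (use SQ in \<open>simp add: Q_def\<close>)
  finally show ?case .
qed simp

lemma trace_supp_SUP:
  assumes T: "T \<in> M" "norm T \<le> 1"
  shows "\<tau> (supp T) = (SUP n. \<tau> (id_blinfun - kernel_approx T n))"
proof (rule trace_normal_sequence)
  have T3: "norm (adj T) \<le> 1" using norm_adj_le T by (meson order_trans)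
  show "id_blinfun - kernel_approx T n \<in> positive_cone M" for n
    using kernel_approx_bounds(3)[OF T, of n] T
    by (intro positive_coneI_selfadjoint)
      (auto intro: diff_M id_M kernel_approx_M
        simp: blinfun.diff_left cinner_simps kernel_approx_selfadjoint norm_sq_cinner)
  show "supp T \<in> positive_cone M" using T by (simp add: projection_positive supp_projection)
  show "Re (cinner ((id_blinfun - kernel_approx T n) x) x)
      \<le> Re (cinner ((id_blinfun - kernel_approx T (Suc n)) x) x)" for n x
    using kernel_approx_Suc_form[OF T(1), of n x]
    by (simp add: blinfun.diff_left cinner_simps del: kernel_approx.simps)
  show "(\<lambda>n. (id_blinfun - kernel_approx T n) x) \<longlonglongrightarrow> supp T x" for x
    using tendsto_diff[OF tendsto_const[of x] kernel_approx_limit[OF T T3, of x]]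
    by (simp add: blinfun.diff_left)
qed

text \<open>Both supports are limits of increasing approximants with equal traces. The approximation
  requires a contraction; scaling to norm one leaves kernels, and with them supports,
  unchanged.\<close>

lemma trace_supp_adj:
  assumes T: "T \<in> M"
  shows "\<tau> (supp (adj T)) = \<tau> (supp T)"
proof (cases "T = 0")
  case True
  have "adj (0 :: 'h \<Rightarrow>\<^sub>L 'h) = 0"
    by (rule adj_eqI) (simp_all add: bounded_ops_def)
  then show ?thesis using True by simp
next
  case False
  define c where "c = inverse (norm T)"
  have c: "c \<noteq> 0" using False by (simp add: c_def)
  let ?T = "c *\<^sub>R T"
  have T': "?T \<in> M" using T by (rule scaleR_M)
  have n: "norm ?T \<le> 1" using False by (simp add: c_def)
  have a: "adj ?T = c *\<^sub>R adj T"
    using T M_bounded_ops[OF T']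
    by (intro adj_eqI) (simp_all add: cinner_adj_M blinfun.scaleR_left cinner_scaleR_left cinner_scaleR_right)
  have "\<tau> (supp (adj ?T)) = \<tau> (supp ?T)"
    using trace_supp_SUP[OF T' n] trace_supp_SUP[OF adj_M[OF T']] trace_kernel_approx[OF T' n]
      norm_adj_le[OF T'] n by simp
  then show ?thesis using c by (simp add: a supp_def blinfun.scaleR_left)
qed

text \<open>The left support \<open>p\<close> of \<open>x = f (1 - e)\<close> lies below
  \<open>f\<close>, and \<open>h = f - p\<close> is annihilated by \<open>adj x\<close>, hence below
  both \<open>e\<close> and \<open>f\<close>. Therefore \<open>1 - g \<le> (1 - f) + p\<close> for
  the meet \<open>g\<close>, and \<open>p\<close> has the trace of the right support of
  \<open>x\<close>, which lies below \<open>1 - e\<close>.\<close>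

lemma trace_perp_inf2:
  assumes e: "e \<in> projections M" and f: "f \<in> projections M"
  shows "\<tau> (perp (proj_inf {e, f})) \<le> \<tau> (perp e) + \<tau> (perp f)"
proof -
  define x where "x = f o\<^sub>L perp e"
  define p where "p = supp (adj x)"
  define g where "g = proj_inf {e, f}"
  define h where "h = f - p"
  have x: "x \<in> M" unfolding x_def by (intro compose_M projection_M perp_projection e f)
  have ax: "adj x z = perp e (f z)" for z
  proof -
    have "adj x = perp e o\<^sub>L f"
      using M_bounded_ops[OF x] projection_selfadjoint[OF f] projection_selfadjoint[OF perp_projection[OF e]]
      unfolding x_def by (intro adj_eqI) (auto simp del: perp_apply)
    then show ?thesis by simp
  qed
  have p: "p \<in> projections M" unfolding p_def by (rule supp_projection[OF adj_M[OF x]])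
  have g: "g \<in> projections M" unfolding g_def by (rule proj_inf_projection) (use e f in auto)
  have pf: "p (f z) = p z" for z
  proof -
    have "adj x (z - f z) = 0" by (simp add: ax blinfun.diff_right projection_idem[OF f])
    then have "p (z - f z) = 0" unfolding p_def using supp_eq_0_iff[OF adj_M[OF x]] by blast
    then show ?thesis by (simp add: blinfun.diff_right)
  qed
  have fp: "f (p z) = p z" for z
    using projection_absorb[OF p f] pf by (metis (no_types) cinner_ext projection_selfadjoint[OF p] projection_selfadjoint[OF f])
  have h: "h \<in> projections M"
    by (rule projectionI) (auto simp: h_def diff_M projection_M e f p blinfun.diff_left
        blinfun.diff_right projection_idem pf fp cinner_simps projection_selfadjoint)
  have gh: "g (h z) = h z" for z
    unfolding g_def
  proof (rule proj_inf_greatest)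
    fix k assume "k \<in> {e, f}"
    moreover have "f (h z) = h z" by (simp add: h_def blinfun.diff_left blinfun.diff_right projection_idem f fp)
    moreover have "p (h z) = 0"
      by (simp add: h_def blinfun.diff_left blinfun.diff_right projection_idem p pf)
    then have "adj x (h z) = 0" unfolding p_def using supp_eq_0_iff[OF adj_M[OF x]] by blast
    ultimately show "k (h z) = h z" by (auto simp: ax)
  qed (use e f in auto)
  have "norm (h z) \<le> norm (g z)" for z
    using projection_absorb[OF g h gh, of z] norm_projection_le[OF h, of "g z"] by simp
  then have hg: "Re (cinner (f z) z) - Re (cinner (p z) z) \<le> Re (cinner (g z) z)" for z
  proof -
    have "Re (cinner (h z) z) \<le> Re (cinner (g z) z)"
      using \<open>\<And>z. norm (h z) \<le> norm (g z)\<close>[of z]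
      by (simp add: cinner_projection[OF g] cinner_projection[OF h] power_mono)
    then show ?thesis by (simp add: h_def blinfun.diff_left cinner_simps)
  qed
  have pp: "perp f \<in> positive_cone M" "p \<in> positive_cone M" "perp g \<in> positive_cone M"
    using f p g by (auto intro: projection_positive perp_projection)
  have "\<tau> (perp g) \<le> \<tau> (perp f + p)"
  proof (rule trace_mono)
    show "perp f + p \<in> positive_cone M"
      using pp by (auto simp: positive_cone_def positive_op_def add_M M_bounded_ops blinfun.add_left
          cinner_simps blinfun.diff_left)
    show "Re (cinner (perp g z) z) \<le> Re (cinner ((perp f + p) z) z)" for z
      using hg[of z] by (simp add: blinfun.add_left cinner_simps)
  qed (use pp in auto)
  also have "\<dots> = \<tau> (perp f) + \<tau> p" by (rule trace_add) (use pp in auto)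
  also have "\<tau> p = \<tau> (supp x)" unfolding p_def by (rule trace_supp_adj[OF x])
  also have "\<dots> \<le> \<tau> (perp e)"
    by (rule trace_projection_mono[OF supp_projection[OF x] perp_projection[OF e]])
      (simp add: supp_eq_0_iff[OF x], simp add: x_def blinfun.zero_right)
  finally show ?thesis by (simp add: g_def add.commute add_left_mono)
qed

text \<open>Finite meets \<open>F n\<close> are handled by induction; their complements increase to
  that of the full meet, where normality applies.\<close>

lemma trace_perp_inf:
  fixes E :: "nat \<Rightarrow> 'h \<Rightarrow>\<^sub>L 'h"
  assumes E: "\<And>n. E n \<in> projections M"
  shows "\<tau> (perp (proj_inf (range E))) \<le> (\<Sum>n. \<tau> (perp (E n)))"
proof -
  define F where "F n = proj_inf (E ` {..n})" for n
  have F: "F n \<in> projections M" for n unfolding F_def by (rule proj_inf_projection) (use E in auto)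
  have fixed: "F n x = x \<longleftrightarrow> (\<forall>k\<le>n. E k x = x)" for n x
    using proj_inf_fixed[of "E ` {..n}" _ x] proj_inf_greatest[of "E ` {..n}" x] E
    by (metis F_def atMost_iff image_eqI imageE image_subsetI)
  have perp0: "perp e x = 0 \<longleftrightarrow> e x = x" for e x by auto
  have le: "\<tau> (perp (F n)) \<le> (\<Sum>k\<le>n. \<tau> (perp (E k)))" for n
  proof (induction n)
    case 0
    have "\<tau> (perp (F 0)) \<le> \<tau> (perp (E 0))"
      by (rule trace_projection_mono) (auto simp: F E perp_projection perp0 fixed simp del: perp_apply)
    then show ?case by simp
  next
    case (Suc n)
    let ?G = "proj_inf {F n, E (Suc n)}"
    have sub: "{F n, E (Suc n)} \<subseteq> projections M" using F E by auto
    have "\<tau> (perp (F (Suc n))) \<le> \<tau> (perp ?G)"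
    proof (rule trace_projection_mono)
      fix x assume "perp ?G x = 0"
      then have "?G x = x" by (simp only: perp0)
      then have "F n x = x" "E (Suc n) x = x" using proj_inf_fixed[OF sub, of _ x] by auto
      then show "perp (F (Suc n)) x = 0" by (simp only: perp0 fixed) (auto simp: le_Suc_eq)
    qed (use F E sub in \<open>auto intro: perp_projection proj_inf_projection\<close>)
    also have "\<dots> \<le> \<tau> (perp (F n)) + \<tau> (perp (E (Suc n)))" by (rule trace_perp_inf2[OF F E])
    also have "\<dots> \<le> (\<Sum>k\<le>n. \<tau> (perp (E k))) + \<tau> (perp (E (Suc n)))" by (rule add_right_mono[OF Suc])
    finally show ?case by simp
  qed
  let ?P = "proj_inf (range F)"
  have P: "?P \<in> projections M" by (rule proj_inf_projection) (use F in auto)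
  have "\<tau> (perp (proj_inf (range E))) \<le> \<tau> (perp ?P)"
  proof (rule trace_projection_mono)
    fix x assume "perp ?P x = 0"
    then have "?P x = x" by (simp only: perp0)
    then have "F n x = x" for n using proj_inf_fixed[of "range F" "F n" x] F by auto
    then have "proj_inf (range E) x = x" using E fixed by (intro proj_inf_greatest) auto
    then show "perp (proj_inf (range E)) x = 0" by (simp only: perp0)
  qed (use E P in \<open>auto intro!: perp_projection proj_inf_projection\<close>)
  also have "\<tau> (perp ?P) = (SUP n. \<tau> (perp (F n)))"
  proof (rule trace_normal_sequence)
    show "(\<lambda>n. perp (F n) x) \<longlonglongrightarrow> perp ?P x" for x
      unfolding perp_apply
      by (intro tendsto_diff tendsto_const projection_decreasing_limit F) (auto simp: fixed)
    show "Re (cinner (perp (F n) x) x) \<le> Re (cinner (perp (F (Suc n)) x) x)" for n x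
    proof -
      have "F n (F (Suc n) z) = F (Suc n) z" for z
        using projection_idem[OF F, of "Suc n" z] by (simp add: fixed)
      then have "F (Suc n) x = F (Suc n) (F n x)" using projection_absorb[OF F F] by metis
      then have "norm (F (Suc n) x) \<le> norm (F n x)" using norm_projection_le[OF F, of "Suc n" "F n x"] by simp
      then show ?thesis by (simp add: cinner_simps cinner_projection[OF F] power_mono)
    qed
  qed (use F P in \<open>auto intro: projection_positive perp_projection\<close>)
  also have "\<dots> \<le> (\<Sum>n. \<tau> (perp (E n)))"
  proof (rule SUP_least)
    fix n
    show "\<tau> (perp (F n)) \<le> (\<Sum>n. \<tau> (perp (E n)))"
      using le[of n] sum_le_suminf[of "\<lambda>n. \<tau> (perp (E n))" "{..n}"] by (meson order_trans summableI finite_atMost zero_le)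
  qed
  finally show ?thesis .
qed

lemma trace_perp_inf_le:
  fixes E :: "nat \<Rightarrow> 'h \<Rightarrow>\<^sub>L 'h"
  assumes E: "\<And>n. E n \<in> projections M" and le: "\<And>n. \<tau> (perp (E n)) \<le> ennreal (\<epsilon> * (1/2) ^ Suc n)"
    and \<epsilon>: "\<epsilon> > 0"
  shows "\<tau> (perp (proj_inf (range E))) \<le> ennreal \<epsilon>"
proof -
  have "(\<lambda>n. \<epsilon> * (1/2) ^ Suc n) sums (\<epsilon> * 1)" by (intro sums_mult power_half_series)
  then have s: "summable (\<lambda>n. \<epsilon> * (1/2) ^ Suc n)" "(\<Sum>n. \<epsilon> * (1/2) ^ Suc n) = \<epsilon>"
    by (simp_all add: sums_iff)
  have "(\<Sum>n. \<tau> (perp (E n))) \<le> (\<Sum>n. ennreal (\<epsilon> * (1/2) ^ Suc n))"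
    by (intro suminf_le le summableI)
  also have "\<dots> = ennreal \<epsilon>" using s \<epsilon> by (subst suminf_ennreal2) auto
  finally show ?thesis using trace_perp_inf[OF E] by (rule order_trans[rotated])
qed

section \<open>Meets over the tails of a sequence of projections\<close>

definition proj_tail :: "(nat \<Rightarrow> 'h \<Rightarrow>\<^sub>L 'h) \<Rightarrow> nat \<Rightarrow> 'h \<Rightarrow>\<^sub>L 'h" where
  "proj_tail E N = proj_inf (E ` {N..})"

context
  fixes E :: "nat \<Rightarrow> 'h \<Rightarrow>\<^sub>L 'h"
  assumes E: "\<And>n. E n \<in> projections M"
begin

lemma proj_tail_projection: "proj_tail E N \<in> projections M"
  unfolding proj_tail_def by (rule proj_inf_projection) (use E in auto)

lemma proj_tail_fixed_iff: "proj_tail E N x = x \<longleftrightarrow> (\<forall>k\<ge>N. E k x = x)"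
  using proj_inf_fixed[of "E ` {N..}" _ x] proj_inf_greatest[of "E ` {N..}" x] E
  by (metis proj_tail_def atLeast_iff image_eqI imageE image_subsetI)

lemma apply_proj_tail: "N \<le> k \<Longrightarrow> E k (proj_tail E N x) = proj_tail E N x"
  using proj_tail_fixed_iff projection_idem[OF proj_tail_projection] by blast

lemma proj_tail_mono: "N \<le> K \<Longrightarrow> proj_tail E K (proj_tail E N x) = proj_tail E N x"
  by (simp add: proj_tail_fixed_iff apply_proj_tail)

lemma trace_perp_proj_tail:
  assumes le: "\<And>n. \<tau> (perp (E n)) \<le> ennreal ((1/2) ^ n)"
  shows "\<tau> (perp (proj_tail E N)) \<le> ennreal (2 * (1/2) ^ N)"
proof -
  have "E ` {N..} = range (\<lambda>n. E (n + N))"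
    by (auto simp: image_iff) (metis add.commute le_iff_add)
  moreover have "\<tau> (perp (proj_inf (range (\<lambda>n. E (n + N))))) \<le> ennreal (2 * (1/2) ^ N)"
  proof (rule trace_perp_inf_le)
    show "\<tau> (perp (E (n + N))) \<le> ennreal (2 * (1 / 2) ^ N * (1 / 2) ^ Suc n)" for n
      using le[of "n + N"] by (simp add: power_add mult.commute)
  qed (use E in auto)
  ultimately show ?thesis by (simp add: proj_tail_def)
qed

text \<open>A Borel-Cantelli argument. A vector killed by all tail meets lies in the range of the
  meet \<open>h\<close> of their complements; the trace of \<open>h\<close> is below
  \<open>2 * (1/2) ^ N\<close> for every \<open>N\<close>, so \<open>h = 0\<close> by
  faithfulness.\<close>

lemma proj_tail_limit:
  assumes le: "\<And>n. \<tau> (perp (E n)) \<le> ennreal ((1/2) ^ n)"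
  shows "(\<lambda>N. proj_tail E N x) \<longlonglongrightarrow> x"
proof (rule projection_increasing_limit)
  show "proj_tail E N x = x" if "m \<le> N" "proj_tail E m x = x" for m N x
    using that by (metis proj_tail_mono)
  fix x assume x: "\<And>n. proj_tail E n x = 0"
  let ?S = "range (\<lambda>N. perp (proj_tail E N))"
  define h where "h = proj_inf ?S"
  have sub: "?S \<subseteq> projections M" by (auto intro: perp_projection proj_tail_projection)
  have h: "h \<in> projections M" unfolding h_def by (rule proj_inf_projection[OF sub])
  have "\<tau> h \<le> ennreal (2 * (1/2) ^ N)" for N
  proof -
    have pr: "perp (proj_tail E N) \<in> projections M" using sub by auto
    have "perp (proj_tail E N) (h z) = h z" for z
      unfolding h_def by (rule proj_inf_fixed[OF sub]) auto
    then have "h (perp (proj_tail E N) z) = h z" for z by (rule projection_absorb[OF pr h])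
    then have "\<tau> h \<le> \<tau> (perp (proj_tail E N))"
      by (intro trace_projection_mono h pr) (metis blinfun.zero_right)
    then show ?thesis using trace_perp_proj_tail[OF le, of N] by (rule order_trans)
  qed
  moreover have "(\<lambda>N. ennreal (2 * (1/2) ^ N)) \<longlonglongrightarrow> ennreal (2 * 0)"
    by (intro tendsto_ennrealI tendsto_mult tendsto_const LIMSEQ_power_zero) simp
  ultimately have "\<tau> h \<le> ennreal (2 * 0)" by (intro LIMSEQ_le_const) auto
  then have "h = 0"
    using fns projection_positive[OF h] by (auto simp: fns_trace_def faithful_trace_def)
  moreover have "h x = x" unfolding h_def by (rule proj_inf_greatest[OF sub]) (auto simp: x)
  ultimately show "x = 0" by simp
qed (rule proj_tail_projection)

end

text \<open>Here smallness in trace becomes an equality of vectors: the tail meets of projections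
  killing \<open>x\<close> also kill \<open>x\<close>, while they converge strongly to 1.\<close>

lemma eq_0_if_small_projections:
  assumes "\<And>\<epsilon>. \<epsilon> > 0 \<Longrightarrow> \<exists>q\<in>projections M. \<tau> (perp q) \<le> ennreal \<epsilon> \<and> blinfun_apply q x = 0"
  shows "x = 0"
proof -
  have "\<exists>q. q \<in> projections M \<and> \<tau> (perp q) \<le> ennreal ((1/2) ^ n) \<and> q x = 0" for n
    using assms[of "(1/2) ^ n"] by auto
  then obtain E where E: "\<And>n. E n \<in> projections M" "\<And>n. \<tau> (perp (E n)) \<le> ennreal ((1/2) ^ n)"
    "\<And>n. E n x = 0" by metis
  have "proj_tail E n x = 0" for n
  proof -
    have "E n (proj_tail E n z) = proj_tail E n z" for z by (simp add: apply_proj_tail E(1))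
    then have "proj_tail E n (E n x) = proj_tail E n x"
      by (rule projection_absorb[OF E(1) proj_tail_projection[OF E(1)]])
    then show ?thesis using E(3) by (simp add: blinfun.zero_right)
  qed
  then have "(\<lambda>n. proj_tail E n x) \<longlonglongrightarrow> 0" by simp
  then show ?thesis using LIMSEQ_unique proj_tail_limit[OF E(1,2)] by blast
qed

end

section \<open>The closed graph theorem\<close>

lemma Baire_closed_cover:
  fixes C :: "nat \<Rightarrow> 'a::complete_space set"
  assumes cl: "\<And>n. closed (C n)" and cover: "(\<Union>n. C n) = UNIV"
  shows "\<exists>n. interior (C n) \<noteq> {}"
proof (rule ccontr)
  assume "\<not> ?thesis"
  then have dense: "closure (- C n) = UNIV" for n by (simp add: closure_complement)
  have "Met_TC.mtopology closure_of (\<Inter>(range (\<lambda>n. - C n))) = UNIV"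
  proof (rule Met_TC.metric_Baire_category)
    show "Met_TC.mcomplete TYPE('a)" by (simp only: mcomplete_iff_complete complete_UNIV)
    fix T assume "T \<in> range (\<lambda>n. - C n)"
    then obtain n where "T = - C n" by blast
    then show "openin Met_TC.mtopology T \<and> Met_TC.mtopology closure_of T = UNIV"
      using cl[of n] dense[of n] by (simp add: open_Compl)
  qed simp
  moreover have "\<Inter>(range (\<lambda>n. - C n)) = {}" using cover by auto
  ultimately show False by simp
qed

text \<open>Baire gives a ball on which \<open>f\<close> is bounded up to approximation; successive
  approximation removes the approximation, with closedness of the graph used only at the
  end.\<close>

theorem closed_graph_theorem:
  fixes f :: "'a::banach \<Rightarrow> 'b::banach"
  assumes f: "linear f" and cl: "closed {(x, f x) | x. True}"
  shows "bounded_linear f"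
proof -
  interpret linear f by (rule f)
  define B where "B n = {x. norm (f x) \<le> real n}" for n
  have "(\<Union>n. closure (B n)) = UNIV"
  proof (rule UNIV_eq_I[symmetric])
    fix x
    obtain n where "norm (f x) \<le> real n" using real_arch_simple by blast
    then have "x \<in> closure (B n)" by (intro subsetD[OF closure_subset]) (simp add: B_def)
    then show "x \<in> (\<Union>n. closure (B n))" by blast
  qed
  then obtain n x0 r where r: "r > 0" "ball x0 r \<subseteq> closure (B n)"
    using Baire_closed_cover[of "\<lambda>n. closure (B n)"] by (metis all_not_in_conv closed_closure mem_interior)
  \<comment> \<open>Half the difference of points of \<open>B n\<close> near \<open>x0 + y\<close>
    and \<open>x0 - y\<close> moves the ball to the origin without enlarging the bound
    \<open>n\<close>.\<close>
  have approx: "\<exists>y'. norm (y - y') < d \<and> norm (f y') \<le> real n" if y: "norm y < r" and d: "d > 0" for y d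
  proof -
    have "x0 + y \<in> closure (B n)" "x0 - y \<in> closure (B n)"
      using r y by (auto simp: dist_norm intro!: subsetD[OF r(2)])
    then obtain a b where ab: "a \<in> B n" "norm (a - (x0 + y)) < d" "b \<in> B n" "norm (b - (x0 - y)) < d"
      using d unfolding closure_approachable dist_norm by metis
    let ?y = "(1/2) *\<^sub>R (a - b)"
    have "2 *\<^sub>R (y - ?y) = (b - (x0 - y)) - (a - (x0 + y))"
      by (simp add: algebra_simps scaleR_2)
    then have "2 * norm (y - ?y) = norm ((b - (x0 - y)) - (a - (x0 + y)))"
      by (metis norm_scaleR abs_numeral)
    then have "2 * norm (y - ?y) < 2 * d"
      using ab norm_triangle_ineq4[of "b - (x0 - y)" "a - (x0 + y)"] by linarith
    moreover have "norm (f ?y) \<le> real n"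
      using ab norm_triangle_ineq4[of "f a" "f b"] by (simp add: B_def scale diff)
    ultimately show ?thesis by (intro exI[of _ ?y]) simp
  qed
  \<comment> \<open>Rescaling \<open>x\<close> to norm \<open>r / 2\<close>, inside the ball, and
    back multiplies the bound \<open>n\<close> by \<open>2 * norm x / r\<close>; the accuracy
    \<open>r / 4\<close> becomes \<open>norm x / 2\<close>.\<close>
  define K where "K = 2 * real n / r"
  have K: "K \<ge> 0" using r by (simp add: K_def)
  have "\<exists>x'. norm (x - x') \<le> norm x / 2 \<and> norm (f x') \<le> K * norm x" for x
  proof (cases "x = 0")
    case True
    then show ?thesis by (intro exI[of _ 0]) (simp add: zero)
  next
    case False
    define t where "t = r / (2 * norm x)"
    have t: "t > 0" using r False by (simp add: t_def)
    have "norm (t *\<^sub>R x) < r" using r False by (simp add: t_def)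
    then obtain y where y: "norm (t *\<^sub>R x - y) < r / 4" "norm (f y) \<le> real n"
      using approx[of "t *\<^sub>R x" "r / 4"] r by auto
    let ?x = "inverse t *\<^sub>R y"
    have "x - ?x = inverse t *\<^sub>R (t *\<^sub>R x - y)" using t by (simp add: scaleR_diff_right)
    then have "norm (x - ?x) = inverse t * norm (t *\<^sub>R x - y)" using t by simp
    also have "\<dots> \<le> inverse t * (r / 4)" using y t by (intro mult_left_mono) auto
    also have "\<dots> = norm x / 2" using r False by (simp add: t_def field_simps)
    finally have 1: "norm (x - ?x) \<le> norm x / 2" .
    have "norm (f ?x) = inverse t * norm (f y)" using t by (simp add: scale)
    also have "\<dots> \<le> inverse t * real n" using y t by (intro mult_left_mono) auto
    also have "\<dots> = K * norm x" using r False by (simp add: t_def K_def field_simps)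
    finally show ?thesis using 1 by blast
  qed
  then obtain g where g: "\<And>x. norm (x - g x) \<le> norm x / 2" "\<And>x. norm (f (g x)) \<le> K * norm x"
    by metis
  have "norm (f x) \<le> norm x * (2 * K)" for x
  proof -
    \<comment> \<open>\<open>s k\<close> is the remainder after \<open>k\<close> corrections. It
      halves at each step, so the corrections sum to \<open>x\<close>, while their images are
      dominated by a geometric series of sum \<open>2 * K * norm x\<close>.\<close>
    define s where "s k = ((\<lambda>x. x - g x) ^^ k) x" for k
    have s: "s 0 = x" "s (Suc k) = s k - g (s k)" for k by (simp_all add: s_def)
    have ns: "norm (s k) \<le> norm x * (1/2) ^ k" for k
    proof (induction k)
      case (Suc k)
      then show ?case using g(1)[of "s k"] by (simp add: s)
    qed (simp add: s)
    have nf: "norm (f (g (s k))) \<le> K * norm x * (1/2) ^ k" for k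
      using g(2)[of "s k"] mult_left_mono[OF ns[of k] K] by (simp add: mult.assoc)
    have geo: "(\<lambda>k. K * norm x * (1/2) ^ k) sums (K * norm x * 2)"
      using sums_mult[OF geometric_sums[of "1/2 :: real"]] by simp
    have sn: "summable (\<lambda>k. norm (f (g (s k))))"
      by (rule summable_comparison_test'[OF sums_summable[OF geo]]) (simp add: nf)
    define \<eta> where "\<eta> = (\<Sum>k. f (g (s k)))"
    have n\<eta>: "norm \<eta> \<le> K * norm x * 2"
      using summable_norm[OF sn] suminf_le[OF nf sn sums_summable[OF geo]] sums_unique[OF geo]
      by (simp add: \<eta>_def)
    have part: "(\<Sum>k<m. g (s k)) = x - s m" for m
      by (induction m) (simp_all add: s)
    have "(\<lambda>m. norm x * (1/2) ^ m) \<longlonglongrightarrow> norm x * 0"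
      by (intro tendsto_mult tendsto_const LIMSEQ_power_zero) simp
    then have "s \<longlonglongrightarrow> 0"
      by (intro Lim_null_comparison[of s]) (auto simp: ns)
    then have "(\<lambda>m. \<Sum>k<m. g (s k)) \<longlonglongrightarrow> x - 0"
      unfolding part by (intro tendsto_intros)
    moreover have "(\<lambda>m. f (\<Sum>k<m. g (s k))) \<longlonglongrightarrow> \<eta>"
      unfolding sum \<eta>_def by (rule summable_LIMSEQ[OF summable_norm_cancel[OF sn]])
    ultimately have "(\<lambda>m. (\<Sum>k<m. g (s k), f (\<Sum>k<m. g (s k)))) \<longlonglongrightarrow> (x, \<eta>)"
      by (intro tendsto_Pair) auto
    then have "(x, \<eta>) \<in> {(x, f x) | x. True}"
      by (rule closed_sequentially[OF cl, rotated]) auto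
    then show ?thesis using n\<eta> by (simp add: mult_ac)
  qed
  then show ?thesis by (intro bounded_linear_intro[where K = "2 * K"]) (auto simp: add scale)
qed


section \<open>Closed operators affiliated with a von Neumann algebra\<close>

text \<open>The graph of a closed operator is a closed subspace of \<open>H \<times> H\<close>, and
  with this instance it has an orthogonal projection. The product norm is Euclidean, as the last
  axiom of the class demands.\<close>

instantiation prod :: (complex_hilbert_space, complex_hilbert_space) complex_hilbert_space
begin

definition scaleC_prod :: "complex \<Rightarrow> 'a \<times> 'b \<Rightarrow> 'a \<times> 'b" where
  "scaleC_prod c p = (scaleC c (fst p), scaleC c (snd p))"

definition cinner_prod :: "'a \<times> 'b \<Rightarrow> 'a \<times> 'b \<Rightarrow> complex" where
  "cinner_prod p q = cinner (fst p) (fst q) + cinner (snd p) (snd q)"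

instance
proof
  fix x y :: "'a \<times> 'b"
  show "cinner x y = cnj (cinner y x)"
    by (simp add: cinner_prod_def flip: cinner_commute)
  show "cinner x x = complex_of_real ((norm x)\<^sup>2)"
    by (simp add: cinner_prod_def cinner_norm norm_prod_def)
qed (simp_all add: scaleC_prod_def cinner_prod_def scaleC_add_right scaleC_add_left scaleC_scaleC
    scaleC_one scaleR_scaleC[symmetric] scaleR_prod_def cinner_simps algebra_simps)

end

lemma
  assumes "linear_operator A"
  shows linear_operator_zero: "(0, 0) \<in> A"
    and linear_operator_add: "(x, u) \<in> A \<Longrightarrow> (y, v) \<in> A \<Longrightarrow> (x + y, u + v) \<in> A"
    and linear_operator_scaleC: "(x, u) \<in> A \<Longrightarrow> (scaleC c x, scaleC c u) \<in> A"
    and linear_operator_unique: "(x, u) \<in> A \<Longrightarrow> (x, w) \<in> A \<Longrightarrow> u = w"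
  using assms by (auto simp: linear_operator_def dest: single_valuedD)

lemma linear_operator_scaleR: "linear_operator A \<Longrightarrow> (x, u) \<in> A \<Longrightarrow> (r *\<^sub>R x, r *\<^sub>R u) \<in> A"
  by (simp add: scaleR_scaleC linear_operator_scaleC)

lemma linear_operator_diff:
  "linear_operator A \<Longrightarrow> (x, u) \<in> A \<Longrightarrow> (y, v) \<in> A \<Longrightarrow> (x - y, u - v) \<in> A"
  using linear_operator_add[of A x u "- y" "- v"] linear_operator_scaleR[of A y v "- 1"] by simp

lemma graph_of_iff [simp]: "(x, y) \<in> graph_of T \<longleftrightarrow> y = blinfun_apply T x"
  by (auto simp: graph_of_def)

lemma inj_graph_of: "inj graph_of"
proof (rule injI, rule blinfun_eqI)
  fix S T :: "'a \<Rightarrow>\<^sub>L 'a" and x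
  assume "graph_of S = graph_of T"
  then have "(x, S x) \<in> graph_of T" by (metis graph_of_iff)
  then show "S x = T x" by simp
qed

lemma closed_graph_of: "closed (graph_of T)"
proof -
  have "graph_of T = {p. snd p = blinfun_apply T (fst p)}" by (auto simp: graph_of_def)
  then show ?thesis
    by (auto intro!: closed_Collect_eq continuous_intros)
qed

text \<open>The composite is the preimage of \<open>A\<close> under a continuous map, so the closure
  in \<open>strong_prod\<close> changes nothing when the right factor is bounded.\<close>

lemma closed_relcomp_graph_of:
  fixes T :: "'h::complex_hilbert_space \<Rightarrow>\<^sub>L 'h"
  assumes "closed A"
  shows "closed (graph_of T O A)"
proof -
  have "graph_of T O A = (\<lambda>p. (blinfun_apply T (fst p), snd p)) -` A"
    by (auto simp: relcomp_unfold)
  then show ?thesis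
    by (auto intro!: closed_vimage assms continuous_intros)
qed

lemma strong_prod_graph_of:
  "closed A \<Longrightarrow> strong_prod A (graph_of T) = graph_of T O A"
  by (simp add: strong_prod_def closed_relcomp_graph_of closure_closed)

lemma strong_prod_eq_graph_ofI:
  assumes "closed A" "single_valued A" "\<And>x. (blinfun_apply e x, blinfun_apply S x) \<in> A"
  shows "strong_prod A (graph_of e) = graph_of S"
proof -
  have "(x, v) \<in> graph_of e O A \<longleftrightarrow> (x, v) \<in> graph_of S" for x v
    using assms(3)[of x] single_valuedD[OF assms(2)] by auto
  then show ?thesis 
    unfolding strong_prod_graph_of[OF assms(1)] by (simp only: set_eq_iff split_paired_All simp_thms)
qed

lemma strong_prod_eq_graph_ofD:
  assumes "closed A" "strong_prod A (graph_of e) = graph_of S"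
  shows "(blinfun_apply e x, blinfun_apply S x) \<in> A"
proof -
  have "(x, blinfun_apply S x) \<in> graph_of e O A"
    using assms by (simp add: strong_prod_graph_of)
  then show ?thesis by auto
qed

text \<open>The map \<open>(x, v) \<mapsto> (x, S x - v)\<close> is a continuous involution of
  \<open>H \<times> H\<close>, so the algebraic difference is already closed and its values are
  known exactly.\<close>

lemma strong_diff_graph_of:
  fixes S :: "'h::complex_hilbert_space \<Rightarrow>\<^sub>L 'h"
  assumes "closed A"
  shows "strong_diff (graph_of S) A = {(x, blinfun_apply S x - v) | x v. (x, v) \<in> A}"
proof -
  have "p \<in> {(x, blinfun_apply S x - v) | x v. (x, v) \<in> A}
      \<longleftrightarrow> (fst p, blinfun_apply S (fst p) - snd p) \<in> A" for p
    by (cases p) (force intro: exI[of _ "blinfun_apply S (fst p) - snd p"])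
  then have "{(x, blinfun_apply S x - v) | x v. (x, v) \<in> A}
      = (\<lambda>p. (fst p, blinfun_apply S (fst p) - snd p)) -` A"
    by (intro set_eqI) (simp only: vimage_eq)
  then have "closed {(x, blinfun_apply S x - v) | x v. (x, v) \<in> A}"
    by (auto intro!: closed_vimage assms continuous_intros)
  moreover have "{(x, u - v) | x u v. (x, u) \<in> graph_of S \<and> (x, v) \<in> A}
      = {(x, blinfun_apply S x - v) | x v. (x, v) \<in> A}" by auto
  ultimately show ?thesis by (simp add: strong_diff_def closure_closed)
qed

lemma strong_diff_graph_of_graph_of:
  "strong_diff (graph_of S) (graph_of T) = graph_of (S - T)"
  by (subst strong_diff_graph_of[OF closed_graph_of]) (auto simp: graph_of_def blinfun.diff_left)

text \<open>For two unbounded operators only this direction is immediate; that the closure adds no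
  second value is \<open>single_valued_strong_diff\<close>.\<close>

lemma strong_diff_memI: "(x, u) \<in> A \<Longrightarrow> (x, v) \<in> B \<Longrightarrow> (x, u - v) \<in> strong_diff A B"
  unfolding strong_diff_def by (rule subsetD[OF closure_subset]) blast

lemma strong_sum_memI: "(x, u) \<in> A \<Longrightarrow> (x, v) \<in> B \<Longrightarrow> (x, u + v) \<in> strong_sum A B"
  unfolding strong_sum_def by (rule subsetD[OF closure_subset]) blast

lemma closed_strong_diff: "closed (strong_diff A B)"
  by (simp add: strong_diff_def)

lemma affiliated_iff:
  "affiliated M A \<longleftrightarrow> (\<forall>y\<in>commutant M. \<forall>x v. (x, v) \<in> A \<longrightarrow> (blinfun_apply y x, blinfun_apply y v) \<in> A)"
  unfolding affiliated_def by (auto simp: relcomp_unfold)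

lemma unif_norm_graph_of: "S \<in> M \<Longrightarrow> unif_norm M (graph_of S) = ennreal (norm S)"
  by (simp add: unif_norm_def inv_into_f_f inj_on_subset[OF inj_graph_of])

lemma unif_norm_leD:
  assumes "unif_norm M A \<le> ennreal \<delta>" "0 \<le> \<delta>"
  obtains S where "S \<in> M" "A = graph_of S" "norm S \<le> \<delta>"
proof -
  have "A \<in> graph_of ` M"
    using assms by (auto simp: unif_norm_def top_unique split: if_splits)
  then show thesis using assms that by (auto simp: unif_norm_graph_of)
qed

context vn_algebra
begin

lemma everywhere_defined_in_M:
  assumes A: "linear_operator A" and aff: "affiliated M A"
    and K: "K \<ge> 0" and bd: "\<And>x. \<exists>v. (x, v) \<in> A \<and> norm v \<le> K * norm x"
  obtains T where "T \<in> M" "A = graph_of T" "norm T \<le> K"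
proof -
  obtain f where f: "\<And>x. (x, f x) \<in> A" "\<And>x. norm (f x) \<le> K * norm x" using bd by metis
  have fI: "(x, v) \<in> A \<longleftrightarrow> v = f x" for x v using f(1) linear_operator_unique[OF A] by blast
  have "bounded_linear f"
    using f linear_operator_add[OF A] linear_operator_scaleR[OF A]
    by (intro bounded_linear_intro[where K = K]) (auto simp: mult.commute fI)
  then have app: "blinfun_apply (Blinfun f) = f" by (rule bounded_linear_Blinfun_apply)
  have "Blinfun f \<in> M"
  proof (rule in_M_I)
    show "Blinfun f \<in> bounded_ops"
      using f(1) linear_operator_scaleC[OF A] by (auto simp: bounded_ops_def app fI)
    show "y (Blinfun f x) = Blinfun f (y x)" if "y \<in> commutant M" for y x
      using aff that f(1)[of x] unfolding affiliated_iff app by (simp add: fI)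
  qed
  moreover have "A = graph_of (Blinfun f)" by (auto simp: graph_of_def app fI)
  moreover have "norm (Blinfun f) \<le> K" by (rule norm_blinfun_bound[OF K]) (simp add: app f)
  ultimately show thesis using that by blast
qed

text \<open>\<open>A e\<close> is closed and everywhere defined, hence bounded; since
  \<open>e\<close> commutes with the commutant, \<open>A e\<close> inherits affiliation and so
  belongs to \<open>M\<close>.\<close>

lemma closed_operator_restrict:
  assumes A: "linear_operator A" "closed A" "affiliated M A" and e: "e \<in> projections M"
    and dom: "range (blinfun_apply e) \<subseteq> Domain A"
  shows "\<exists>T\<in>M. \<forall>x. (blinfun_apply e x, blinfun_apply T x) \<in> A"
proof -
  have eM: "e \<in> M" by (rule projection_M[OF e])
  let ?B = "graph_of e O A"
  have B: "(x, v) \<in> ?B \<longleftrightarrow> (e x, v) \<in> A" for x v by auto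
  have lin: "linear_operator ?B"
    unfolding linear_operator_def single_valued_def B
    using A(1) eM by (auto simp: blinfun.zero_right blinfun.add_right M_scaleC
        linear_operator_zero linear_operator_add linear_operator_scaleC dest: linear_operator_unique)
  have aff: "affiliated M ?B"
    using A(3) M_commute[OF eM] unfolding affiliated_iff B by metis
  obtain f where f: "\<And>x. (e x, f x) \<in> A" 
  proof -
    have "\<exists>v. (e x, v) \<in> A" for x using dom by blast
    then show thesis using that by metis
  qed
  have gr: "?B = {(x, f x) | x. True}"
    using f linear_operator_unique[OF A(1)] by (auto simp: B)
  have "linear f"
  proof (rule linearI)
    show "f (x + y) = f x + f y" for x y
      using linear_operator_add[OF lin, of x "f x" y "f y"] by (auto simp: gr)
    show "f (r *\<^sub>R x) = r *\<^sub>R f x" for r x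
      using linear_operator_scaleR[OF lin, of x "f x" r] by (auto simp: gr)
  qed
  then have "bounded_linear f"
    using closed_relcomp_graph_of[OF A(2), of e] gr by (intro closed_graph_theorem) auto
  then obtain K where K: "K \<ge> 0" "\<And>x. norm (f x) \<le> norm x * K" using bounded_linear.nonneg_bounded by blast
  have "\<exists>v. (x, v) \<in> ?B \<and> norm v \<le> K * norm x" for x
    using K(2)[of x] f[of x] by (auto simp: B mult.commute)
  then obtain T where T: "T \<in> M" "?B = graph_of T"
    using everywhere_defined_in_M[OF lin aff K(1)] by blast
  have "(e x, T x) \<in> A" for x using B[of x "T x"] T(2) by simp
  then show ?thesis using T(1) by blast
qed

end

context traced_algebra
begin

text \<open>Let \<open>Q\<close> be the projection of \<open>H \<times> H\<close> onto the graph of \<open>A\<close> restricted to the kernel of \<open>e\<close>, and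
  \<open>x\<close> its upper right corner. The values of that restriction are orthogonal to the kernel of \<open>x\<close>,
  and \<open>e x = 0\<close>, so that the trace of \<open>supp x\<close> is at most that of \<open>1 - e\<close>.\<close>

lemma range_projection_of_restriction:
  assumes A: "linear_operator A" "closed A" "affiliated M A" and e: "e \<in> projections M"
  shows "\<exists>p\<in>projections M. \<tau> p \<le> \<tau> (perp e) \<and>
    (\<forall>x v. (x, v) \<in> A \<longrightarrow> blinfun_apply e x = 0 \<longrightarrow> blinfun_apply p v = v)"
proof -
  have eM: "e \<in> M" by (rule projection_M[OF e])
  define N where "N = A \<inter> {p. e (fst p) = 0}"
  have N_iff: "(x, v) \<in> N \<longleftrightarrow> (x, v) \<in> A \<and> e x = 0" for x v by (simp add: N_def)
  have N: "csubspace N" "closed N"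
  proof -
    show "csubspace N"
      using A(1) eM by (auto simp: csubspace_def N_def zero_prod_def scaleC_prod_def blinfun.zero_right
          blinfun.add_right M_scaleC linear_operator_zero linear_operator_add linear_operator_scaleC)
    show "closed N"
      unfolding N_def by (intro closed_Int A closed_Collect_eq continuous_intros)
  qed
  have N_inv: "(y x, y v) \<in> N" if "y \<in> commutant M" "(x, v) \<in> N" for y x v
    using that A(3) M_commute[OF eM that(1), of x] by (auto simp: N_iff affiliated_iff blinfun.zero_right)
  let ?Q = "blinfun_apply (proj_onto N)"
  define x where "x = Blinfun (\<lambda>z. fst (?Q (0, z)))"
  have "bounded_linear (\<lambda>z. fst (?Q (0, z)))"
    by (intro bounded_linear_compose[OF bounded_linear_fst]
        bounded_linear_compose[OF blinfun.bounded_linear_right] bounded_linear_Pair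
        bounded_linear_zero bounded_linear_ident)
  then have x_app: "blinfun_apply x = (\<lambda>z. fst (?Q (0, z)))"
    unfolding x_def by (rule bounded_linear_Blinfun_apply)
  have x: "x \<in> M"
  proof (rule in_M_I)
    have "?Q (0, scaleC c z) = scaleC c (?Q (0, z))" for c z
      using bounded_ops_scaleC[OF proj_onto_in_bounded_ops[OF N], of c "(0, z)"]
      by (simp add: scaleC_prod_def)
    then show "x \<in> bounded_ops" by (simp add: bounded_ops_def x_app scaleC_prod_def)
    fix y z assume y: "y \<in> commutant M"
    have b: "y \<in> bounded_ops" using y by (simp add: commutant_def)
    obtain q1 q2 where q: "?Q (0, z) = (q1, q2)" by fastforce
    \<comment> \<open>\<open>y\<close> acts diagonally on pairs. This action preserves
      \<open>N\<close> and, through \<open>adj y\<close>, also its orthogonal complement, so it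
      commutes with the projection.\<close>
    have "?Q (0, y z) = (y q1, y q2)"
    proof (rule proj_onto_eqI[OF N])
      show "(y q1, y q2) \<in> N" using N_inv[OF y] proj_onto_in[OF N, of "(0, z)"] by (simp add: q)
      have "cinner ((0, y z) - (y q1, y q2)) w = 0" if w: "w \<in> N" for w
      proof -
        have "(adj y (fst w), adj y (snd w)) \<in> N"
          using N_inv[OF adj_commutant[OF y], of "fst w" "snd w"] w by simp
        then have "cinner ((0, z) - (q1, q2)) (adj y (fst w), adj y (snd w)) = 0"
          using diff_proj_onto[OF N, of "(0, z)"] unfolding q ocomp_def by blast
        then show ?thesis
          by (simp add: cinner_prod_def cinner_simps cinner_adj[OF b])
      qed
      then show "(0, y z) - (y q1, y q2) \<in> ocomp N" by (simp add: ocomp_def)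
    qed
    then show "y (x z) = x (y z)" by (simp add: x_app q)
  qed
  have ex: "e (x z) = 0" for z
    using proj_onto_in[OF N, of "(0, z)"] by (simp add: x_app N_def)
  have "\<tau> (supp x) = \<tau> (supp (adj x))" by (rule trace_supp_adj[OF x, symmetric])
  also have "\<dots> \<le> \<tau> (perp e)"
  proof (rule trace_projection_mono[OF supp_projection[OF adj_M[OF x]] perp_projection[OF e]])
    fix z assume "perp e z = 0"
    then have ez: "e z = z" by simp
    have "adj x z = 0"
    proof (rule cinner_ext)
      fix w
      have "cinner (adj x z) w = cinner (e z) (x w)" by (simp add: ez cinner_adj_M'[OF x])
      then show "cinner (adj x z) w = cinner 0 w" by (simp add: projection_selfadjoint[OF e] ex)
    qed
    then show "supp (adj x) z = 0" by (simp add: supp_eq_0_iff[OF adj_M[OF x]])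
  qed
  finally have tr: "\<tau> (supp x) \<le> \<tau> (perp e)" .
  have "supp x v = v" if A1: "(u, v) \<in> A" "e u = 0" for u v
  proof -
    have "cinner v z = 0" if z: "x z = 0" for z
    proof -
      \<comment> \<open>Single-valuedness enters here: a point of the graph over 0 is zero, so
        \<open>(0, z)\<close> is orthogonal to the restricted graph.\<close>
      obtain q2 where q: "?Q (0, z) = (0, q2)" using z by (metis x_app prod.collapse)
      then have "(0, q2) \<in> A" using proj_onto_in[OF N, of "(0, z)"] by (simp add: N_iff)
      then have "q2 = 0" using linear_operator_unique[OF A(1) _ linear_operator_zero[OF A(1)]] by blast
      then have "(0, z) \<in> ocomp N" using diff_proj_onto[OF N, of "(0, z)"] by (simp add: q)
      then have "cinner (0, z) (u, v) = 0" using A1 unfolding ocomp_def by (simp add: N_iff)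
      then show ?thesis by (simp add: cinner_prod_def cinner_eq_0_commute)
    qed
    then have "v \<in> ocomp {z. x z = 0}" by (simp add: ocomp_def)
    then show ?thesis
      using proj_onto_eq_0[OF csubspace_kernel[OF M_bounded_ops[OF x]]] by (simp add: supp_def)
  qed
  then show ?thesis using tr supp_projection[OF x] by blast
qed

section \<open>Measurable operators and the single-valuedness of their differences\<close>

lemma measurable_opsD:
  assumes "A \<in> measurable_ops M \<tau>"
  shows "linear_operator A" "closed A" "affiliated M A"
  using assms by (auto simp: measurable_ops_def closed_densely_defined_def)

lemma measurable_ops_domain:
  assumes "A \<in> measurable_ops M \<tau>" "\<epsilon> > 0"
  obtains e where "e \<in> projections M" "\<tau> (perp e) \<le> ennreal \<epsilon>" "range (blinfun_apply e) \<subseteq> Domain A"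
  using assms by (auto simp: measurable_ops_def)

lemma trace_zero: "\<tau> 0 = 0"
proof -
  have "0 \<in> positive_cone M" by (rule positive_coneI[OF zero_M, of "\<lambda>_. 0"]) auto
  then have "\<tau> (0 *\<^sub>R 0) = ennreal 0 * \<tau> 0"
    using fns unfolding fns_trace_def trace_on_def by blast
  then show ?thesis by simp
qed

lemma graph_of_measurable:
  assumes T: "T \<in> M"
  shows "graph_of T \<in> measurable_ops M \<tau>"
proof -
  have "Domain (graph_of T) = UNIV" by (auto simp: graph_of_def)
  moreover have "linear_operator (graph_of T)"
    using T by (auto simp: linear_operator_def single_valued_def blinfun.zero_right blinfun.add_right M_scaleC)
  moreover have "affiliated M (graph_of T)"
    using M_commute[OF T] by (auto simp: affiliated_iff)
  ultimately show ?thesis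
    using id_projection by (auto simp: measurable_ops_def closed_densely_defined_def closed_graph_of
        perp_def trace_zero intro!: bexI[of _ id_blinfun])
qed

text \<open>For \<open>A\<close> bounded on the range of \<open>e\<close>, the operator \<open>q A\<close> is bounded if \<open>q\<close> annihilates the values
  of \<open>A\<close> on the kernel of \<open>e\<close>.\<close>

lemma measurable_ops_bounded_after_projection:
  assumes A: "A \<in> measurable_ops M \<tau>" and \<epsilon>: "\<epsilon> > 0"
  shows "\<exists>q\<in>projections M. \<exists>S\<in>M. \<tau> (perp q) \<le> ennreal \<epsilon> \<and>
    (\<forall>x v. (x, v) \<in> A \<longrightarrow> blinfun_apply q v = blinfun_apply S x)"
proof -
  note A' = measurable_opsD[OF A]
  obtain e where e: "e \<in> projections M" "\<tau> (perp e) \<le> ennreal \<epsilon>" "range (blinfun_apply e) \<subseteq> Domain A"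
    using measurable_ops_domain[OF A \<epsilon>] by blast
  obtain T where T: "T \<in> M" "\<And>x. (e x, T x) \<in> A"
    using closed_operator_restrict[OF A' e(1,3)] by blast
  obtain p where p: "p \<in> projections M" "\<tau> p \<le> \<tau> (perp e)" "\<And>x v. (x, v) \<in> A \<Longrightarrow> e x = 0 \<Longrightarrow> p v = v"
    using range_projection_of_restriction[OF A' e(1)] by blast
  have "perp p v = (perp p o\<^sub>L T) x" if "(x, v) \<in> A" for x v
  proof -
    have "(x - e x, v - T x) \<in> A" by (rule linear_operator_diff[OF A'(1) that T(2)])
    then have "p (v - T x) = v - T x"
      by (rule p(3)) (simp add: blinfun.diff_right projection_idem[OF e(1)])
    then show ?thesis by (simp add: blinfun.diff_right algebra_simps)
  qed
  moreover have "\<tau> (perp (perp p)) \<le> ennreal \<epsilon>" using order_trans[OF p(2) e(2)] by simp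
  moreover have "perp p \<in> projections M" by (rule perp_projection[OF p(1)])
  ultimately show ?thesis using compose_M[OF projection_M T(1), of "perp p"] by blast
qed

text \<open>After a projection \<open>q\<close> of small cotrace both operators are restrictions of
  bounded ones. The values of the algebraic difference then satisfy a continuous equation
  determining \<open>q v\<close> from \<open>x\<close>, and this equation survives the
  closure.\<close>

lemma single_valued_strong_diff:
  assumes A: "A \<in> measurable_ops M \<tau>" and B: "B \<in> measurable_ops M \<tau>"
  shows "single_valued (strong_diff A B)"
proof (rule single_valuedI)
  fix x v v' assume v: "(x, v) \<in> strong_diff A B" "(x, v') \<in> strong_diff A B"
  have "v - v' = 0"
  proof (rule eq_0_if_small_projections)
    fix \<epsilon> :: real assume \<epsilon>: "\<epsilon> > 0"
    obtain q1 and S1 :: "'h \<Rightarrow>\<^sub>L 'h" where 1: "q1 \<in> projections M" "S1 \<in> M" "\<tau> (perp q1) \<le> ennreal (\<epsilon> / 2)"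
      "\<And>x v. (x, v) \<in> A \<Longrightarrow> q1 v = S1 x"
      using measurable_ops_bounded_after_projection[OF A half_gt_zero[OF \<epsilon>]] by metis
    obtain q2 and S2 :: "'h \<Rightarrow>\<^sub>L 'h" where 2: "q2 \<in> projections M" "S2 \<in> M" "\<tau> (perp q2) \<le> ennreal (\<epsilon> / 2)"
      "\<And>x v. (x, v) \<in> B \<Longrightarrow> q2 v = S2 x"
      using measurable_ops_bounded_after_projection[OF B half_gt_zero[OF \<epsilon>]] by metis
    define q where "q = proj_inf {q1, q2}"
    have sub: "{q1, q2} \<subseteq> projections M" using 1 2 by auto
    have q: "q \<in> projections M" unfolding q_def by (rule proj_inf_projection[OF sub])
    have "\<tau> (perp q) \<le> ennreal (\<epsilon> / 2) + ennreal (\<epsilon> / 2)"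
      unfolding q_def by (rule order_trans[OF trace_perp_inf2[OF 1(1) 2(1)] add_mono[OF 1(3) 2(3)]])
    then have tr: "\<tau> (perp q) \<le> ennreal \<epsilon>" using \<epsilon> by (simp flip: ennreal_plus)
    have q1: "q (q1 z) = q z" and q2: "q (q2 z) = q z" for z
      using projection_absorb[OF 1(1) q] projection_absorb[OF 2(1) q] proj_inf_fixed[OF sub]
      by (auto simp: q_def)
    let ?C = "{p. q (snd p) = q (S1 (fst p)) - q (S2 (fst p))}"
    have "{(x, u - v) | x u v. (x, u) \<in> A \<and> (x, v) \<in> B} \<subseteq> ?C"
    proof (clarsimp simp: blinfun.diff_right)
      fix x u w assume "(x, u) \<in> A" "(x, w) \<in> B"
      then show "q u - q w = q (S1 x) - q (S2 x)"
        using 1(4)[of x u] 2(4)[of x w] q1[of u] q2[of w] by simp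
    qed
    moreover have "closed ?C" by (intro closed_Collect_eq continuous_intros)
    ultimately have C: "strong_diff A B \<subseteq> ?C" unfolding strong_diff_def by (rule closure_minimal)
    have "q v = q v'" using subsetD[OF C v(1)] subsetD[OF C v(2)] by simp
    then show "\<exists>q\<in>projections M. \<tau> (perp q) \<le> ennreal \<epsilon> \<and> q (v - v') = 0"
      using q tr by (intro bexI[of _ q]) (auto simp: blinfun.diff_right)
  qed
  then show "v = v'" by simp
qed

end

section \<open>The measure topology and almost uniform convergence\<close>

lemma exists_half_power_le:
  fixes e :: real
  assumes "e > 0"
  shows "\<exists>k\<ge>J. (1/2) ^ k \<le> e"
proof -
  obtain k where "(1/2 :: real) ^ k < e" using real_arch_pow_inv[OF assms, of "1/2"] by auto
  moreover have "(1/2 :: real) ^ max k J \<le> (1/2) ^ k" by (intro power_decreasing) auto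
  ultimately have "(1/2 :: real) ^ max k J \<le> e" by linarith
  then show ?thesis by (intro exI[of _ "max k J"]) simp
qed

context traced_algebra
begin

lemma exists_common_subprojection:
  assumes e: "e \<in> projections M" "\<tau> (perp e) \<le> ennreal a" "a \<ge> 0"
    and f: "f \<in> projections M" "\<tau> (perp f) \<le> ennreal b" "b \<ge> 0"
  shows "\<exists>g\<in>projections M. \<tau> (perp g) \<le> ennreal (a + b) \<and>
    (\<forall>x. blinfun_apply g x = x \<longrightarrow> blinfun_apply e x = x \<and> blinfun_apply f x = x)"
proof (intro bexI conjI allI impI)
  let ?g = "proj_inf {e, f}"
  have sub: "{e, f} \<subseteq> projections M" using e f by auto
  show "?g \<in> projections M" by (rule proj_inf_projection[OF sub])
  have "\<tau> (perp ?g) \<le> ennreal a + ennreal b"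
    by (rule order_trans[OF trace_perp_inf2[OF e(1) f(1)] add_mono[OF e(2) f(2)]])
  then show "\<tau> (perp ?g) \<le> ennreal (a + b)" using e f by simp
  show "e x = x" "f x = x" if "?g x = x" for x
    using proj_inf_fixed[OF sub, of e x] proj_inf_fixed[OF sub, of f x] that by auto
qed

text \<open>The weights \<open>\<epsilon> * (1/2) ^ Suc n\<close> let one projection serve all
  \<open>n\<close>, through countable subadditivity.\<close>

lemma exists_common_domain:
  fixes A :: "nat \<Rightarrow> 'h operator"
  assumes A: "\<And>n. A n \<in> measurable_ops M \<tau>" and \<epsilon>: "\<epsilon> > 0"
  shows "\<exists>g\<in>projections M. \<tau> (perp g) \<le> ennreal \<epsilon> \<and>
    (\<forall>x n. blinfun_apply g x = x \<longrightarrow> (\<exists>v. (x, v) \<in> A n))"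
proof -
  have "\<exists>e. e \<in> projections M \<and> \<tau> (perp e) \<le> ennreal (\<epsilon> * (1/2) ^ Suc n) \<and> range (blinfun_apply e) \<subseteq> Domain (A n)" for n
    using measurable_ops_domain[OF A[of n], of "\<epsilon> * (1/2) ^ Suc n"] \<epsilon> by force
  then obtain E where E: "\<And>n. E n \<in> projections M" "\<And>n. \<tau> (perp (E n)) \<le> ennreal (\<epsilon> * (1/2) ^ Suc n)"
    "\<And>n. range (blinfun_apply (E n)) \<subseteq> Domain (A n)" by metis
  let ?g = "proj_inf (range E)"
  have sub: "range E \<subseteq> projections M" using E by auto
  show ?thesis
  proof (intro bexI conjI allI impI)
    show "?g \<in> projections M" by (rule proj_inf_projection[OF sub])
    show "\<tau> (perp ?g) \<le> ennreal \<epsilon>" by (rule trace_perp_inf_le[OF E(1,2) \<epsilon>])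
    fix x n assume "?g x = x"
    then have "E n x = x" using proj_inf_fixed[OF sub, of "E n" x] by auto
    then have "x \<in> range (blinfun_apply (E n))" by (metis rangeI)
    then show "\<exists>v. (x, v) \<in> A n" using E(3)[of n] by blast
  qed
qed

lemma graph_of_in_meas_nhd_iff:
  assumes T: "T \<in> M" and \<delta>: "\<delta> \<ge> 0"
  shows "graph_of T \<in> meas_nhd M \<tau> \<epsilon> \<delta> \<longleftrightarrow>
    (\<exists>e\<in>projections M. \<tau> (perp e) \<le> ennreal \<epsilon> \<and> norm (T o\<^sub>L e) \<le> \<delta>)"
proof -
  have "strong_prod (graph_of T) (graph_of e) = graph_of (T o\<^sub>L e)" for e
    by (rule strong_prod_eq_graph_ofI[OF closed_graph_of]) (auto simp: single_valued_def)
  then show ?thesis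
    using graph_of_measurable[OF T] \<delta> compose_M[OF T projection_M]
    by (auto simp: meas_nhd_def unif_norm_graph_of)
qed

text \<open>A measurable operator in the closure of the unit ball is bounded by \<open>1 + \<delta>\<close> on a projection of
  small cotrace for every \<open>\<delta>\<close>, hence on a dense set, and it is closed.\<close>

lemma unit_ball_closed_in_measure:
  assumes A: "A \<in> measurable_ops M \<tau>"
    and cl: "\<And>\<epsilon> \<delta>. \<epsilon> > 0 \<Longrightarrow> \<delta> > 0 \<Longrightarrow>
      \<exists>c\<in>unit_ball M. strong_diff (graph_of c) A \<in> meas_nhd M \<tau> \<epsilon> \<delta>"
  shows "A \<in> graph_of ` unit_ball M"
proof -
  note A' = measurable_opsD[OF A]
  have "\<exists>e. e \<in> projections M \<and> \<tau> (perp e) \<le> ennreal ((1/2) ^ n) \<and>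
      (\<forall>x. e x = x \<longrightarrow> (\<exists>v. (x, v) \<in> A \<and> norm v \<le> (1 + (1/2) ^ n) * norm x))" for n
  proof -
    obtain c where c: "c \<in> unit_ball M" "strong_diff (graph_of c) A \<in> meas_nhd M \<tau> ((1/2) ^ n) ((1/2) ^ n)"
      using cl[of "(1/2) ^ n" "(1/2) ^ n"] by auto
    then obtain e where e: "e \<in> projections M" "\<tau> (perp e) \<le> ennreal ((1/2) ^ n)"
      "unif_norm M (strong_prod (strong_diff (graph_of c) A) (graph_of e)) \<le> ennreal ((1/2) ^ n)"
      by (auto simp: meas_nhd_def)
    obtain S where S: "S \<in> M" "strong_prod (strong_diff (graph_of c) A) (graph_of e) = graph_of S"
      "norm S \<le> (1/2) ^ n"
      using unif_norm_leD[OF e(3)] by auto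
    have "\<exists>v. (x, v) \<in> A \<and> norm v \<le> (1 + (1/2) ^ n) * norm x" if ex: "e x = x" for x
    proof -
      have "(e x, S x) \<in> strong_diff (graph_of c) A"
        by (rule strong_prod_eq_graph_ofD[OF closed_strong_diff S(2)])
      then obtain v where v: "(x, v) \<in> A" "S x = c x - v"
        unfolding strong_diff_graph_of[OF A'(2)] ex by auto
      have "norm v \<le> norm (c x) + norm (S x)" using norm_triangle_ineq4[of "c x" "S x"] v by simp
      also have "\<dots> \<le> 1 * norm x + (1/2) ^ n * norm x"
        using c(1) S(3)
        by (intro add_mono order_trans[OF norm_blinfun] mult_right_mono) (auto simp: unit_ball_def)
      finally show ?thesis using v by (auto simp: algebra_simps)
    qed
    then show ?thesis using e by blast
  qed
  then obtain E where E: "\<And>n. E n \<in> projections M" "\<And>n. \<tau> (perp (E n)) \<le> ennreal ((1/2) ^ n)"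
    "\<And>n x. E n x = x \<Longrightarrow> \<exists>v. (x, v) \<in> A \<and> norm v \<le> (1 + (1/2) ^ n) * norm x"
    by metis
  define F where "F = proj_tail E"
  have F: "F N \<in> projections M" for N unfolding F_def by (rule proj_tail_projection[OF E(1)])
  have bd: "\<exists>v. (x, v) \<in> A \<and> norm v \<le> norm x" if x: "F N x = x" for N x
  proof -
    \<comment> \<open>A vector fixed by the tail meet satisfies the estimates for all
      \<open>k \<ge> N\<close>, so the tolerance \<open>(1/2) ^ k\<close> disappears in the
      limit.\<close>
    have Ex: "E k x = x" if "k \<ge> N" for k
      using x that proj_tail_fixed_iff[of E, OF E(1)] by (simp add: F_def)
    obtain v where v: "(x, v) \<in> A" using E(3)[OF Ex[OF order_refl]] by blast
    have "norm v \<le> (1 + (1/2) ^ k) * norm x" if "k \<ge> N" for k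
      using E(3)[OF Ex[OF that]] linear_operator_unique[OF A'(1) v] by blast
    moreover have "(\<lambda>k. (1 + (1/2) ^ k) * norm x) \<longlonglongrightarrow> (1 + 0) * norm x"
      by (intro tendsto_intros LIMSEQ_power_zero) simp
    ultimately have "norm v \<le> (1 + 0) * norm x"
      by (intro LIMSEQ_le_const) auto
    then show ?thesis using v by auto
  qed
  have "\<exists>v. (x, v) \<in> A \<and> norm v \<le> 1 * norm x" for x
  proof -
    have "\<exists>v. (F N x, v) \<in> A \<and> norm v \<le> norm (F N x)" for N by (rule bd[OF projection_idem[OF F]])
    then obtain v where v: "\<And>N. (F N x, v N) \<in> A" "\<And>N. norm (v N) \<le> norm (F N x)" by metis
    have lim: "(\<lambda>N. F N x) \<longlonglongrightarrow> x" unfolding F_def by (rule proj_tail_limit[OF E(1,2)])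
    \<comment> \<open>Both vectors lie in the range of the later tail meet, where \<open>A\<close>
      is a contraction; hence \<open>v\<close> is Cauchy along with \<open>F N x\<close>.\<close>
    have diff: "norm (v N - v K) \<le> norm (F N x - F K x)" for N K
    proof -
      have "F (max N K) (F N x - F K x) = F N x - F K x"
        by (simp add: F_def blinfun.diff_right proj_tail_mono[OF E(1)])
      then obtain w where "(F N x - F K x, w) \<in> A" "norm w \<le> norm (F N x - F K x)" using bd by blast
      moreover have "(F N x - F K x, v N - v K) \<in> A" by (rule linear_operator_diff[OF A'(1) v(1) v(1)])
      ultimately show ?thesis using linear_operator_unique[OF A'(1)] by blast
    qed
    have "Cauchy (\<lambda>N. F N x)" using LIMSEQ_imp_Cauchy[OF lim] .
    then have "Cauchy v" unfolding Cauchy_def dist_norm using diff by (meson le_less_trans)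
    then obtain w where w: "v \<longlonglongrightarrow> w" using Cauchy_convergent convergent_def by blast
    have "(\<lambda>N. (F N x, v N)) \<longlonglongrightarrow> (x, w)" by (intro tendsto_Pair lim w)
    then have "(x, w) \<in> A" by (rule closed_sequentially[OF A'(2), rotated]) (rule v)
    moreover have "norm (v N) \<le> norm x" for N
      using v(2)[of N] norm_projection_le[OF F, of N x] by (rule order_trans)
    then have "norm w \<le> norm x" by (intro LIMSEQ_le_const2[OF tendsto_norm[OF w]]) auto
    ultimately show ?thesis by auto
  qed
  then obtain T where "T \<in> M" "A = graph_of T" "norm T \<le> 1"
    using everywhere_defined_in_M[OF A'(1,3), of 1] by auto
  then show ?thesis by (auto simp: unit_ball_def)
qed

text \<open>At a point \<open>A\<close> where every basic translate meets the image of
  \<open>C\<close>, \<open>unit_ball_closed_in_measure\<close> first places \<open>A\<close> in the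
  unit ball; only then does \<open>cl\<close> apply.\<close>

lemma closedin_unit_ballI:
  assumes C: "C \<subseteq> unit_ball M"
    and cl: "\<And>x. x \<in> unit_ball M \<Longrightarrow> (\<And>\<epsilon> \<delta>. \<epsilon> > 0 \<Longrightarrow> \<delta> > 0 \<Longrightarrow>
      \<exists>c\<in>C. graph_of (c - x) \<in> meas_nhd M \<tau> \<epsilon> \<delta>) \<Longrightarrow> x \<in> C"
  shows "closedin (measure_subtopology M \<tau> (unit_ball M)) C"
proof -
  let ?V = "measurable_ops M \<tau> - graph_of ` C"
  have ball: "unit_ball M \<subseteq> M" by (auto simp: unit_ball_def)
  have "meas_open M \<tau> ?V"
    unfolding meas_open_def
  proof (intro conjI ballI)
    fix A assume A: "A \<in> ?V"
    show "\<exists>\<epsilon>>0. \<exists>\<delta>>0. {B \<in> measurable_ops M \<tau>. strong_diff B A \<in> meas_nhd M \<tau> \<epsilon> \<delta>} \<subseteq> ?V"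
    proof (rule ccontr)
      assume "\<not> ?thesis"
      then have *: "\<exists>c\<in>C. strong_diff (graph_of c) A \<in> meas_nhd M \<tau> \<epsilon> \<delta>" if "\<epsilon> > 0" "\<delta> > 0" for \<epsilon> \<delta>
        using that by blast
      then have "A \<in> graph_of ` unit_ball M"
        using A C by (intro unit_ball_closed_in_measure) blast+
      then obtain x where x: "x \<in> unit_ball M" "A = graph_of x" by blast
      then have "x \<in> C"
        using * by (intro cl) (auto simp: strong_diff_graph_of_graph_of)
      then show False using A x by blast
    qed
  qed blast
  then have V: "openin (measure_topology M \<tau>) ?V" by (simp add: openin_measure_topology)
  have "unit_ball M - C = graph_of -` ?V \<inter> unit_ball M"
    using graph_of_measurable ball injD[OF inj_graph_of] by blast
  then have "openin (measure_subtopology M \<tau> (unit_ball M)) (unit_ball M - C)"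
    using V unfolding measure_subtopology_def openin_pullback_topology by blast
  moreover have "topspace (measure_subtopology M \<tau> (unit_ball M)) = unit_ball M"
    using subsetD[OF ball] graph_of_measurable
    by (auto simp: measure_subtopology_def topspace_pullback_topology topspace_measure_topology)
  ultimately show ?thesis using C by (simp add: closedin_def)
qed

text \<open>The passage from uniform norms to vectors. Single-valuedness of the strong difference
  identifies \<open>w - v\<close> with the value of the bounded operator whose norm is controlled.
  As only a Cauchy estimate will be drawn from it, \<open>w\<close> is left anonymous.\<close>

lemma converges_au_pointwise:
  fixes y :: "nat \<Rightarrow> 'h operator"
  assumes y: "\<And>n. y n \<in> measurable_ops M \<tau>" and l: "l \<in> measurable_ops M \<tau>"
    and conv: "converges_au M \<tau> y l" and \<epsilon>: "\<epsilon> > 0" and \<delta>: "\<delta> > 0"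
  shows "\<exists>g\<in>projections M. \<exists>N. \<tau> (perp g) \<le> ennreal \<epsilon> \<and>
    (\<forall>x. blinfun_apply g x = x \<longrightarrow>
      (\<exists>w. (\<forall>n\<ge>N. \<forall>v. (x, v) \<in> y n \<longrightarrow> norm (w - v) \<le> \<delta> * norm x)))"
proof -
  obtain e where e: "e \<in> projections M" "\<tau> (perp e) \<le> ennreal (\<epsilon> / 2)"
    "(\<lambda>n. unif_norm M (strong_prod (strong_diff l (y n)) (graph_of e))) \<longlonglongrightarrow> 0"
    using conv half_gt_zero[OF \<epsilon>] unfolding converges_au_def by blast
  \<comment> \<open>A finite bound includes membership in \<open>M\<close>; for indices before
    \<open>N\<close> the norm may be infinite.\<close>
  have "eventually (\<lambda>n. unif_norm M (strong_prod (strong_diff l (y n)) (graph_of e)) < ennreal \<delta>) sequentially"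
    by (rule order_tendstoD(2)[OF e(3)]) (simp add: \<delta>)
  then obtain N where N: "\<And>n. n \<ge> N \<Longrightarrow>
      unif_norm M (strong_prod (strong_diff l (y n)) (graph_of e)) \<le> ennreal \<delta>"
    unfolding eventually_sequentially by (meson less_imp_le)
  obtain h where h: "h \<in> projections M" "\<tau> (perp h) \<le> ennreal (\<epsilon> / 2)"
    "\<And>x n. h x = x \<Longrightarrow> \<exists>v. (x, v) \<in> l"
    using exists_common_domain[of "\<lambda>_. l" "\<epsilon> / 2"] l \<epsilon> by auto
  obtain g where g: "g \<in> projections M" "\<tau> (perp g) \<le> ennreal (\<epsilon> / 2 + \<epsilon> / 2)"
    "\<And>x. g x = x \<Longrightarrow> e x = x \<and> h x = x"
    using exists_common_subprojection[OF e(1,2) _ h(1,2)] \<epsilon> by auto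
  have "\<exists>w. \<forall>n\<ge>N. \<forall>v. (x, v) \<in> y n \<longrightarrow> norm (w - v) \<le> \<delta> * norm x" if x: "g x = x" for x
  proof -
    obtain w where w: "(x, w) \<in> l" using g(3)[OF x] h(3) by blast
    have "norm (w - v) \<le> \<delta> * norm x" if n: "n \<ge> N" and v: "(x, v) \<in> y n" for n v
    proof -
      obtain S where S: "strong_prod (strong_diff l (y n)) (graph_of e) = graph_of S" "norm S \<le> \<delta>"
        using unif_norm_leD[OF N[OF n] less_imp_le[OF \<delta>]] by blast
      have "(e x, S x) \<in> strong_diff l (y n)"
        by (rule strong_prod_eq_graph_ofD[OF closed_strong_diff S(1)])
      then have "w - v = S x"
        using single_valuedD[OF single_valued_strong_diff[OF l y]] strong_diff_memI[OF w v] g(3)[OF x]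
        by metis
      then show ?thesis using norm_blinfun[of S x] mult_right_mono[OF S(2), of "norm x"] by simp
    qed
    then show ?thesis by blast
  qed
  then show ?thesis using g by (intro bexI[of _ g] exI[of _ N]) auto
qed

text \<open>Formulated with values at vectors, so that differences \<open>b n - b m\<close> of
  unbounded operators need not be formed. The range of \<open>g\<close> lies in every domain, while
  the estimate starts at \<open>N\<close>.\<close>

definition au_Cauchy :: "(nat \<Rightarrow> 'h operator) \<Rightarrow> bool" where
  "au_Cauchy b \<longleftrightarrow> (\<forall>\<epsilon>>0. \<forall>\<delta>>0. \<exists>g\<in>projections M. \<exists>N. \<tau> (perp g) \<le> ennreal \<epsilon> \<and>
     (\<forall>x. blinfun_apply g x = x \<longrightarrow> (\<exists>v. (\<forall>n. (x, v n) \<in> b n) \<and>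
        (\<forall>n\<ge>N. \<forall>m\<ge>N. norm (v n - v m) \<le> \<delta> * norm x))))"

lemma au_Cauchy_in_closure:
  fixes a :: "nat \<Rightarrow> ('h \<Rightarrow>\<^sub>L 'h) \<Rightarrow> 'h operator"
  assumes meas: "\<And>n x. x \<in> M \<Longrightarrow> a n x \<in> measurable_ops M \<tau>"
    and add: "\<And>n x y. x \<in> M \<Longrightarrow> y \<in> M \<Longrightarrow> a n (x + y) = strong_sum (a n x) (a n y)"
    and equi: "uniformly_equicontinuous_at_0 M \<tau> (unit_ball M) a"
    and x: "x \<in> unit_ball M"
    and C: "\<And>c. c \<in> C \<Longrightarrow> c \<in> unit_ball M \<and> (\<exists>l\<in>measurable_ops M \<tau>. converges_au M \<tau> (\<lambda>n. a n c) l)"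
    and approx: "\<And>\<epsilon> \<delta>. \<epsilon> > 0 \<Longrightarrow> \<delta> > 0 \<Longrightarrow> \<exists>c\<in>C. graph_of (c - x) \<in> meas_nhd M \<tau> \<epsilon> \<delta>"
  shows "au_Cauchy (\<lambda>n. a n x)"
  unfolding au_Cauchy_def
proof (intro allI impI)
  fix \<epsilon> \<delta> :: real assume \<epsilon>: "\<epsilon> > 0" and \<delta>: "\<delta> > 0"
  \<comment> \<open>Three projections are intersected below: for the smallness of
    \<open>a n y\<close>, for the convergence of \<open>a n c\<close>, and for the domains of
    \<open>a n x\<close>. The divisor 6 in \<open>\<delta>'\<close> counts two errors of
    \<open>a n c\<close> and four occurrences of \<open>a n y\<close>.\<close>
  define \<epsilon>' where "\<epsilon>' = \<epsilon> / 4"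
  define \<delta>' where "\<delta>' = \<delta> / 6"
  have pos: "\<epsilon>' > 0" "\<delta>' > 0" using \<epsilon> \<delta> by (auto simp: \<epsilon>'_def \<delta>'_def)
  have xM: "x \<in> M" "norm x \<le> 1" using x by (auto simp: unit_ball_def)
  obtain U where U: "openin (measure_subtopology M \<tau> M) U" "0 \<in> U"
    "\<And>y. y \<in> unit_ball M \<inter> U \<Longrightarrow> \<exists>e\<in>projections M. \<tau> (perp e) \<le> ennreal \<epsilon>' \<and>
      (\<forall>n. strong_prod (a n y) (graph_of e) \<in> graph_of ` M) \<and>
      (SUP n. unif_norm M (strong_prod (a n y) (graph_of e))) \<le> ennreal \<delta>'"
    using equi[unfolded uniformly_equicontinuous_at_0_def, rule_format, OF pos] by blast
  obtain W where W: "meas_open M \<tau> W" "U = graph_of -` W \<inter> M"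
    using U(1) unfolding measure_subtopology_def openin_pullback_topology openin_measure_topology by blast
  have "graph_of 0 \<in> W" using U(2) W(2) by auto
  then obtain \<epsilon>0 \<delta>0 where nhd: "\<epsilon>0 > 0" "\<delta>0 > 0"
    "{B \<in> measurable_ops M \<tau>. strong_diff B (graph_of 0) \<in> meas_nhd M \<tau> \<epsilon>0 \<delta>0} \<subseteq> W"
    using bspec[OF conjunct2[OF W(1)[unfolded meas_open_def]]] by blast
  obtain c where c: "c \<in> C" "graph_of (c - x) \<in> meas_nhd M \<tau> \<epsilon>0 \<delta>0" using approx nhd by blast
  have cM: "c \<in> M" "norm c \<le> 1" using C[OF c(1)] by (auto simp: unit_ball_def)
  define y where "y = (1/2) *\<^sub>R (c - x)"
  have yM: "y \<in> M" unfolding y_def by (intro scaleR_M diff_M cM xM)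
  have "norm y \<le> 1" using norm_triangle_ineq4[of c x] cM xM by (simp add: y_def)
  then have y1: "y \<in> unit_ball M" using yM by (simp add: unit_ball_def)
  have c_eq: "c = x + (y + y)" by (simp add: y_def flip: scaleR_add_left)
  obtain e0 where e0: "e0 \<in> projections M" "\<tau> (perp e0) \<le> ennreal \<epsilon>0" "norm ((c - x) o\<^sub>L e0) \<le> \<delta>0"
    using c(2) nhd(2) by (auto simp: graph_of_in_meas_nhd_iff diff_M cM xM)
  have "y o\<^sub>L e0 = (1/2) *\<^sub>R ((c - x) o\<^sub>L e0)"
    unfolding y_def by (rule blinfun_eqI) (simp add: blinfun.scaleR_left)
  then have "norm (y o\<^sub>L e0) \<le> \<delta>0" using e0(3) nhd(2) by simp
  then have "graph_of y \<in> meas_nhd M \<tau> \<epsilon>0 \<delta>0"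
    using e0 nhd yM by (auto simp: graph_of_in_meas_nhd_iff)
  then have "y \<in> U" using nhd(3) graph_of_measurable[OF yM] yM
    by (auto simp: W(2) strong_diff_graph_of_graph_of)
  then obtain e where e: "e \<in> projections M" "\<tau> (perp e) \<le> ennreal \<epsilon>'"
    "(SUP n. unif_norm M (strong_prod (a n y) (graph_of e))) \<le> ennreal \<delta>'"
    using U(3)[OF IntI[OF y1]] by blast
  have ey: "\<exists>w. (z, w) \<in> a n y \<and> norm w \<le> \<delta>' * norm z" if "e z = z" for z n
  proof -
    have "unif_norm M (strong_prod (a n y) (graph_of e)) \<le> ennreal \<delta>'"
      using e(3) by (rule order_trans[rotated]) (auto intro: SUP_upper)
    then obtain S where S: "strong_prod (a n y) (graph_of e) = graph_of S" "norm S \<le> \<delta>'"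
      using unif_norm_leD[OF _ less_imp_le[OF pos(2)]] by blast
    have "(e z, S z) \<in> a n y"
      by (rule strong_prod_eq_graph_ofD[OF measurable_opsD(2)[OF meas[OF yM]] S(1)])
    then show ?thesis
      using that norm_blinfun[of S z] mult_right_mono[OF S(2), of "norm z"] by force
  qed
  obtain l where l: "l \<in> measurable_ops M \<tau>" "converges_au M \<tau> (\<lambda>n. a n c) l" using C[OF c(1)] by blast
  obtain f N where f: "f \<in> projections M" "\<tau> (perp f) \<le> ennreal \<epsilon>'"
    "\<And>z. f z = z \<Longrightarrow> \<exists>w. \<forall>n\<ge>N. \<forall>v. (z, v) \<in> a n c \<longrightarrow> norm (w - v) \<le> \<delta>' * norm z"
    using converges_au_pointwise[OF meas[OF cM(1)] l pos] by blast
  obtain h where h: "h \<in> projections M" "\<tau> (perp h) \<le> ennreal \<epsilon>'"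
    "\<And>z n. h z = z \<Longrightarrow> \<exists>v. (z, v) \<in> a n x"
    using exists_common_domain[of "\<lambda>n. a n x", OF meas[OF xM(1)] pos(1)] by blast
  obtain g1 where g1: "g1 \<in> projections M" "\<tau> (perp g1) \<le> ennreal (\<epsilon>' + \<epsilon>')"
    "\<And>z. g1 z = z \<Longrightarrow> e z = z \<and> f z = z"
    using exists_common_subprojection[OF e(1,2) _ f(1,2)] pos by auto
  obtain g where g: "g \<in> projections M" "\<tau> (perp g) \<le> ennreal (\<epsilon>' + \<epsilon>' + \<epsilon>')"
    "\<And>z. g z = z \<Longrightarrow> g1 z = z \<and> h z = z"
    using exists_common_subprojection[OF g1(1,2) _ h(1,2)] pos by auto
  have "\<tau> (perp g) \<le> ennreal \<epsilon>"
    using \<epsilon> by (intro order_trans[OF g(2)] ennreal_leI) (simp add: \<epsilon>'_def)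
  moreover have "\<exists>v. (\<forall>n. (z, v n) \<in> a n x) \<and> (\<forall>n\<ge>N. \<forall>m\<ge>N. norm (v n - v m) \<le> \<delta> * norm z)"
    if z: "g z = z" for z
  proof -
    have fixed: "e z = z" "f z = z" "h z = z" using g(3)[OF z] g1(3) by auto
    obtain v where v: "\<And>n. (z, v n) \<in> a n x" using h(3)[OF fixed(3)] by metis
    obtain u where u: "\<And>n. (z, u n) \<in> a n y" "\<And>n. norm (u n) \<le> \<delta>' * norm z"
      using ey[OF fixed(1)] by metis
    obtain w where w: "\<And>n v. n \<ge> N \<Longrightarrow> (z, v) \<in> a n c \<Longrightarrow> norm (w - v) \<le> \<delta>' * norm z"
      using f(3)[OF fixed(2)] by blast
    \<comment> \<open>Membership in the strong sum is enough, because the estimate with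
      \<open>w\<close> holds for every value of \<open>a n c\<close> at \<open>z\<close>.\<close>
    have "(z, v n + (u n + u n)) \<in> a n c" for n
      unfolding c_eq using xM yM by (simp add: add add_M strong_sum_memI u v)
    then have near: "norm (w - (v n + (u n + u n))) \<le> \<delta>' * norm z" if "n \<ge> N" for n
      using w that by blast
    have "norm (v n - v m) \<le> \<delta> * norm z" if "n \<ge> N" "m \<ge> N" for n m
    proof -
      let ?p = "w - (v m + (u m + u m))" and ?q = "w - (v n + (u n + u n))"
      have "v n - v m = ?p - ?q + ((u m + u m) - (u n + u n))" by simp
      then have "norm (v n - v m) \<le> norm ?p + norm ?q + ((norm (u m) + norm (u m)) + (norm (u n) + norm (u n)))"
        using norm_triangle_ineq[of "?p - ?q" "(u m + u m) - (u n + u n)"] norm_triangle_ineq4[of ?p ?q]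
          norm_triangle_ineq4[of "u m + u m" "u n + u n"] norm_triangle_ineq[of "u m" "u m"]
          norm_triangle_ineq[of "u n" "u n"] by (simp only:)
      also have "\<dots> \<le> 6 * (\<delta>' * norm z)"
        using near[OF that(1)] near[OF that(2)] u(2)[of m] u(2)[of n] by linarith
      finally show ?thesis by (simp add: \<delta>'_def)
    qed
    then show ?thesis using v by blast
  qed
  ultimately show "\<exists>g\<in>projections M. \<exists>N. \<tau> (perp g) \<le> ennreal \<epsilon> \<and>
     (\<forall>z. g z = z \<longrightarrow> (\<exists>v. (\<forall>n. (z, v n) \<in> a n x) \<and>
        (\<forall>n\<ge>N. \<forall>m\<ge>N. norm (v n - v m) \<le> \<delta> * norm z)))"
    using g(1) by blast
qed

text \<open>For fixed \<open>J\<close> the bounded operators \<open>t J n\<close>, which are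
  \<open>b n\<close> after \<open>G J\<close>, converge in norm to some \<open>T J\<close>. These
  limits are compatible on the increasing ranges of the \<open>G J\<close>, and the task is to glue
  them into one closed operator.\<close>

lemma au_Cauchy_imp_converges_au:
  fixes b :: "nat \<Rightarrow> 'h operator"
  assumes b: "\<And>n. b n \<in> measurable_ops M \<tau>" and Cauchy: "au_Cauchy b"
  shows "\<exists>l\<in>measurable_ops M \<tau>. converges_au M \<tau> b l"
proof -
  note b' = measurable_opsD[OF b]
  have "\<exists>g N. g \<in> projections M \<and> \<tau> (perp g) \<le> ennreal ((1/2) ^ k) \<and>
     (\<forall>x. g x = x \<longrightarrow> (\<exists>v. (\<forall>n. (x, v n) \<in> b n) \<and>
        (\<forall>n\<ge>N. \<forall>m\<ge>N. norm (v n - v m) \<le> (1/2) ^ k * norm x)))" for k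
    using Cauchy[unfolded au_Cauchy_def, rule_format, of "(1/2) ^ k" "(1/2) ^ k"] by auto
  then obtain g and N :: "nat \<Rightarrow> nat" where g: "\<And>k. g k \<in> projections M" "\<And>k. \<tau> (perp (g k)) \<le> ennreal ((1/2) ^ k)"
    "\<And>k x. g k x = x \<Longrightarrow> (\<exists>v. (\<forall>n. (x, v n) \<in> b n) \<and>
        (\<forall>n\<ge>N k. \<forall>m\<ge>N k. norm (v n - v m) \<le> (1/2) ^ k * norm x))"
    by metis
  define G where "G = proj_tail g"
  have G: "G J \<in> projections M" for J unfolding G_def by (rule proj_tail_projection[OF g(1)])
  have G_mono: "G K (G J x) = G J x" if "J \<le> K" for J K x
    unfolding G_def by (rule proj_tail_mono[OF g(1) that])
  have G_tr: "\<tau> (perp (G J)) \<le> ennreal (2 * (1/2) ^ J)" for J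
    unfolding G_def by (rule trace_perp_proj_tail[OF g(1,2)])
  have gG: "g k (G J x) = G J x" if "J \<le> k" for J k x
    unfolding G_def by (rule apply_proj_tail[OF g(1) that])
  have "\<exists>T\<in>M. \<forall>x. (G J x, T x) \<in> b n" for J n
  proof (rule closed_operator_restrict[OF b' G])
    show "range (blinfun_apply (G J)) \<subseteq> Domain (b n)"
      using g(3)[OF gG[OF order_refl]] by blast
  qed
  then obtain t where t: "\<And>J n. t J n \<in> M" "\<And>J n x. (G J x, t J n x) \<in> b n" by metis
  \<comment> \<open>The range of \<open>G J\<close> is fixed by every \<open>g k\<close> with
    \<open>k \<ge> J\<close>, so all tolerances \<open>(1/2) ^ k\<close> are available on it and
    norm convergence follows.\<close>
  have t_near: "norm (t J n - t J m) \<le> (1/2) ^ k" if le: "J \<le> k" "n \<ge> N k" "m \<ge> N k" for J k n m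
  proof (rule norm_blinfun_bound)
    fix x
    obtain v where v: "\<And>n. (G J x, v n) \<in> b n"
      "\<And>n m. n \<ge> N k \<Longrightarrow> m \<ge> N k \<Longrightarrow> norm (v n - v m) \<le> (1/2) ^ k * norm (G J x)"
      using g(3)[OF gG[OF le(1)], of x] by blast
    have "t J n x = v n" for n by (rule linear_operator_unique[OF b'(1) t(2) v(1)])
    then have "norm ((t J n - t J m) x) \<le> (1/2) ^ k * norm (G J x)"
      using v(2)[OF le(2,3)] by (simp add: blinfun.diff_left)
    also have "\<dots> \<le> (1/2) ^ k * norm x" by (intro mult_left_mono norm_projection_le G) simp
    finally show "norm ((t J n - t J m) x) \<le> (1/2) ^ k * norm x" .
  qed simp
  have "Cauchy (t J)" for J
  proof (rule metric_CauchyI)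
    fix e :: real assume e: "e > 0"
    obtain k where k: "k \<ge> J" "(1/2) ^ k \<le> e / 2" using exists_half_power_le[OF half_gt_zero[OF e]] by blast
    have "dist (t J m) (t J n) < e" if "m \<ge> N k" "n \<ge> N k" for m n
      using t_near[OF k(1) that] k(2) e by (simp add: dist_norm)
    then show "\<exists>N. \<forall>m\<ge>N. \<forall>n\<ge>N. dist (t J m) (t J n) < e" by blast
  qed
  then have "\<exists>S. t J \<longlonglongrightarrow> S" for J using Cauchy_convergent convergent_def by blast
  then obtain T where T: "\<And>J. t J \<longlonglongrightarrow> T J" by metis
  have TM: "T J \<in> M" for J by (rule limit_M[OF t(1) T])
  have T_G: "T K (G J x) = T J x" if "J \<le> K" for J K x
  proof (rule LIMSEQ_unique)
    show "(\<lambda>n. t K n (G J x)) \<longlonglongrightarrow> T K (G J x)"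
      by (rule bounded_linear.tendsto[OF blinfun.bounded_linear_left T])
    have "t K n (G J x) = t J n x" for n
      using linear_operator_unique[OF b'(1) _ t(2)[of J x n]] t(2)[of K "G J x" n] G_mono[OF that, of x] by simp
    then show "(\<lambda>n. t K n (G J x)) \<longlonglongrightarrow> T J x"
      using bounded_linear.tendsto[OF blinfun.bounded_linear_left T] by simp
  qed

  text \<open>The limits \<open>T J\<close> need not be bounded uniformly, but the increments \<open>T (J + 1) - T J\<close>
    have range projections of summable trace; cutting those off makes \<open>q T\<close> eventually constant, which
    gives the limit operator as a single-valued closed graph.\<close>

  have "\<exists>p. p \<in> projections M \<and> \<tau> p \<le> \<tau> (perp (G (Suc j))) \<and>
      (\<forall>x. G (Suc j) x = 0 \<longrightarrow> p (T (Suc (Suc j)) x) = T (Suc (Suc j)) x)" for j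
    using range_projection_of_restriction[OF measurable_opsD[OF graph_of_measurable[OF TM]] G[of "Suc j"],
        of "Suc (Suc j)"] by (metis graph_of_iff)
  then obtain p where p: "\<And>j. p j \<in> projections M" "\<And>j. \<tau> (p j) \<le> \<tau> (perp (G (Suc j)))"
    "\<And>j x. G (Suc j) x = 0 \<Longrightarrow> p j (T (Suc (Suc j)) x) = T (Suc (Suc j)) x"
    by metis
  define E where "E j = perp (p j)" for j
  have E: "E j \<in> projections M" for j unfolding E_def by (rule perp_projection[OF p(1)])
  have E_tr: "\<tau> (perp (E j)) \<le> ennreal ((1/2) ^ j)" for j
    using order_trans[OF p(2) G_tr, of j] by (simp add: E_def)
  \<comment> \<open>By compatibility, \<open>T (Suc (Suc j))\<close> at
    \<open>x - G (Suc j) x\<close> is the increment of \<open>T\<close> at \<open>x\<close>;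
    \<open>p j\<close> fixes it, so \<open>E j\<close> annihilates it.\<close>
  have E_T: "E j (T (Suc (Suc j)) x) = E j (T (Suc j) x)" for j x
  proof -
    have "p j (T (Suc (Suc j)) (x - G (Suc j) x)) = T (Suc (Suc j)) (x - G (Suc j) x)"
      by (rule p(3)) (simp add: blinfun.diff_right projection_idem[OF G])
    then show ?thesis by (simp add: E_def blinfun.diff_right T_G algebra_simps)
  qed
  define q where "q = proj_tail E"
  have q: "q J \<in> projections M" for J unfolding q_def by (rule proj_tail_projection[OF E])
  have q_E: "q J (E j z) = q J z" if "J \<le> j" for J j z
    by (rule projection_absorb[OF E q]) (unfold q_def, rule apply_proj_tail[of E, OF E that])
  have q_T: "q J (T i x) = q J (T (Suc J) x)" if "i \<ge> Suc J" for J i x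
    using that
  proof (induction i rule: dec_induct)
    case (step i)
    obtain j where j: "i = Suc j" "J \<le> j" using step(1) by (metis Suc_le_D Suc_le_mono)
    have "q J (T (Suc i) x) = q J (E j (T (Suc (Suc j)) x))" by (simp add: q_E j)
    also have "\<dots> = q J (T i x)" by (simp add: E_T q_E j)
    finally show ?case using step by simp
  qed simp
  \<comment> \<open>\<open>q J (T (Suc J) x)\<close> is the value at which
    \<open>q J (T i x)\<close> has stabilized. As a system of equations between bounded operators,
    \<open>l\<close> is closed, linear and affiliated at once; single-valuedness follows from
    \<open>q J\<close> tending strongly to 1.\<close>
  define l where "l = {(x, v). \<forall>J. q J v = q J (T (Suc J) x)}"
  have l_iff: "(x, v) \<in> l \<longleftrightarrow> (\<forall>J. q J v = q J (T (Suc J) x))" for x v by (simp add: l_def)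
  have G_l: "(G j x, T j x) \<in> l" for j x
    unfolding l_iff
  proof
    fix J
    \<comment> \<open>The index \<open>max j (Suc J)\<close> is late enough both for the stability
      under \<open>q J\<close> and for compatibility on the range of \<open>G j\<close>.\<close>
    have "q J (T (Suc J) (G j x)) = q J (T (max j (Suc J)) (G j x))" by (rule q_T[symmetric]) simp
    then show "q J (T j x) = q J (T (Suc J) (G j x))" by (simp add: T_G)
  qed
  have lin: "linear_operator l"
    unfolding linear_operator_def
  proof (intro conjI allI impI)
    show "single_valued l"
    proof (rule single_valuedI)
      fix x v w assume "(x, v) \<in> l" "(x, w) \<in> l"
      then have "q J (v - w) = 0" for J by (simp add: l_iff blinfun.diff_right)
      moreover have "(\<lambda>J. q J (v - w)) \<longlonglongrightarrow> v - w"
        unfolding q_def by (rule proj_tail_limit[OF E E_tr])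
      ultimately show "v = w" by (simp add: LIMSEQ_const_iff)
    qed
  qed (auto simp: l_iff blinfun.zero_right blinfun.add_right M_scaleC[OF TM] M_scaleC[OF projection_M[OF q]])
  have "closed l"
  proof -
    have "l = (\<Inter>J. {p. q J (snd p) = q J (T (Suc J) (fst p))})" by (auto simp: l_def)
    then show ?thesis by (auto intro!: closed_INT closed_Collect_eq continuous_intros)
  qed
  moreover have "closure (Domain l) = UNIV"
  proof (rule UNIV_eq_I[symmetric])
    fix x
    have "(\<lambda>J. G J x) \<longlonglongrightarrow> x" unfolding G_def by (rule proj_tail_limit[OF g(1,2)])
    moreover have "G J x \<in> Domain l" for J using G_l by blast
    ultimately show "x \<in> closure (Domain l)" 
      unfolding closure_sequential by (intro exI[of _ "\<lambda>J. G J x"]) simp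
  qed
  moreover have "affiliated M l"
    unfolding affiliated_iff l_iff
    by (metis M_commute TM projection_M q)
  moreover have "\<exists>e\<in>projections M. \<tau> (perp e) \<le> ennreal \<epsilon> \<and> range (blinfun_apply e) \<subseteq> Domain l"
    if \<epsilon>: "\<epsilon> > 0" for \<epsilon>
  proof -
    obtain J where "(1/2) ^ J \<le> \<epsilon> / 2" using exists_half_power_le[OF half_gt_zero[OF \<epsilon>]] by blast
    then have "ennreal (2 * (1/2) ^ J) \<le> ennreal \<epsilon>" by (intro ennreal_leI) simp
    then have "\<tau> (perp (G J)) \<le> ennreal \<epsilon>" using G_tr[of J] by (rule order_trans[rotated])
    moreover have "range (blinfun_apply (G J)) \<subseteq> Domain l" using G_l by blast
    ultimately show ?thesis using G by blast
  qed
  ultimately have l: "l \<in> measurable_ops M \<tau>"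
    using lin by (simp add: measurable_ops_def closed_densely_defined_def)
  have "converges_au M \<tau> b l"
    unfolding converges_au_def
  proof (intro allI impI)
    fix \<epsilon> :: real assume \<epsilon>: "\<epsilon> > 0"
    obtain J where "(1/2) ^ J \<le> \<epsilon> / 2" using exists_half_power_le[OF half_gt_zero[OF \<epsilon>]] by blast
    then have "ennreal (2 * (1/2) ^ J) \<le> ennreal \<epsilon>" by (intro ennreal_leI) simp
    then have tr: "\<tau> (perp (G J)) \<le> ennreal \<epsilon>" using G_tr[of J] by (rule order_trans[rotated])
    \<comment> \<open>On the range of \<open>G J\<close> both operators have explicit values,
      \<open>T J x\<close> and \<open>t J n x\<close>; single-valuedness excludes any other value of
      the difference.\<close>
    have "strong_prod (strong_diff l (b n)) (graph_of (G J)) = graph_of (T J - t J n)" for n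
      by (rule strong_prod_eq_graph_ofI[OF closed_strong_diff single_valued_strong_diff[OF l b]])
        (simp add: blinfun.diff_left strong_diff_memI G_l t)
    then have "unif_norm M (strong_prod (strong_diff l (b n)) (graph_of (G J))) = ennreal (norm (T J - t J n))" for n
      by (simp add: unif_norm_graph_of diff_M TM t)
    moreover have "(\<lambda>n. ennreal (norm (T J - t J n))) \<longlonglongrightarrow> ennreal (norm (T J - T J))"
      by (intro tendsto_ennrealI tendsto_intros T)
    ultimately show "\<exists>e\<in>projections M. \<tau> (perp e) \<le> ennreal \<epsilon> \<and>
        (\<lambda>n. unif_norm M (strong_prod (strong_diff l (b n)) (graph_of e))) \<longlonglongrightarrow> 0"
      using G tr by (intro bexI[of _ "G J"]) auto
  qed
  then show ?thesis using l by blast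
qed

end

theorem theorem3p7:
  fixes M :: "('h::complex_hilbert_space \<Rightarrow>\<^sub>L 'h) set"
    and \<tau> :: "('h \<Rightarrow>\<^sub>L 'h) \<Rightarrow> ennreal"
    and a :: "nat \<Rightarrow> ('h \<Rightarrow>\<^sub>L 'h) \<Rightarrow> 'h operator"
  assumes "von_neumann_algebra M"
    and "fns_trace M \<tau>"
    and "\<And>n x. x \<in> M \<Longrightarrow> a n x \<in> measurable_ops M \<tau>"
    and "\<And>n x y. x \<in> M \<Longrightarrow> y \<in> M \<Longrightarrow> a n (x + y) = strong_sum (a n x) (a n y)"
    and "uniformly_equicontinuous_at_0 M \<tau> (unit_ball M) a"
  shows "closedin (measure_subtopology M \<tau> (unit_ball M))
    {x \<in> unit_ball M. \<exists>l \<in> measurable_ops M \<tau>. converges_au M \<tau> (\<lambda>n. a n x) l}"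
    (is "closedin _ ?C")
proof -
  interpret traced_algebra M \<tau> by unfold_locales (rule assms)+
  show ?thesis
  proof (rule closedin_unit_ballI)
    fix x assume x: "x \<in> unit_ball M"
      and approx: "\<And>\<epsilon> \<delta>. \<epsilon> > 0 \<Longrightarrow> \<delta> > 0 \<Longrightarrow> \<exists>c\<in>?C. graph_of (c - x) \<in> meas_nhd M \<tau> \<epsilon> \<delta>"
    have "au_Cauchy (\<lambda>n. a n x)"
      by (rule au_Cauchy_in_closure[OF assms(3-5) x _ approx]) auto
    moreover have "a n x \<in> measurable_ops M \<tau>" for n using x assms(3) by (simp add: unit_ball_def)
    ultimately have "\<exists>l\<in>measurable_ops M \<tau>. converges_au M \<tau> (\<lambda>n. a n x) l"
      by (intro au_Cauchy_imp_converges_au)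
    then show "x \<in> ?C" using x by simp
  qed blast
qed

end
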